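(* Let $\tau>1$ be an integer and let $\mathbb{V}$ be a value domain with $|\mathbb{V}|=2^D>1$. The storage cost (number $n$ of objects, each holding one block) of any regular, wait-free, $\tau$-common write emulation of a multi-reader single-writer register over $\mathbb{V}$ with $R$ readers (whose $\mathtt{read}$s may be visible) is at least $$\tau+(\tau-1)\cdot\min\left(2^D-1,\,R\right)$$ blocks.
   Context: **Model.** An asynchronous shared memory system consists of a finite set $O=\{o_1,\dots,o_n\}$ of objects (the shared storage) and a set $\Pi$ of processes. Each entity $e\in O\cup\Pi$ stores data $e.\mathit{data}$ and potentially infinite meta-data $e.\mathit{meta}$. An object's data is a single block from some domain $\mathbb{B}$; a process' data is an array of up to $L\ge1$ blocks from $\mathbb{B}$. The storage cost is $n$, the number of objects. Objects support atomic, instantaneous actions by processes: $o.\mathtt{update}_p$ is an arbitrary read-modify-write that possibly writes a block to $o.\mathit{data}$ and modifies $o.\mathit{meta}$, $p.\mathit{meta}$ and $p.\mathit{data}$; $o.\mathtt{get}_p$ may replace a block in $p.\mathit{data}$ with $o.\mathit{data}$ and may modify $p.\mathit{meta}$. An algorithm defines processes as deterministic state machines whose transitions are associated with actions; an action associated with a transition from the current state is called enabled. A configuration assigns states (data and meta) to all processes and objects. A run is a finite or infinite alternating sequence of configurations and actions (events), starting at an initial configuration and following the algorithm; events are invocations and responses (returns) of high-level operations and $\mathtt{get}$/$\mathtt{update}$ occurrences. Time $t$ in a run $r$ is the configuration after the $t$-th event. Each process' first action is an invocation and it has at most one pending (invoked, not returned) operation at any time. Two operations are concurrent if both are invoked before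 either returns. $e.\mathit{data}(r,t)$ is the set of distinct blocks in $e.\mathit{data}$ at time $t$ in $r$ (for an object, identified with its single block). Process $p$ obtains block $b$ at time $t$ in $r$ if $b\notin p.\mathit{data}(r,t)$ and $b\in p.\mathit{data}(r,t+1)$. **Register emulation.** The algorithm emulates a register over a domain $\mathbb{V}$, $|\mathbb{V}|=2^D>1$, with high-level operations $\mathtt{read}_p$ and $\mathtt{write}(v)$, $v\in\mathbb{V}$. Each run begins with a dummy initialization operation writing the initial value and overlapping no operation. Single-writer: only one process, the writer, invokes $\mathtt{write}$s; the other $R=|\Pi|-1$ processes (readers) invoke only $\mathtt{read}$s. Multi-reader means $R>1$. Whenever a $\mathtt{read}_p$ is invoked at time $t$ in $r$, $p.\mathit{data}(r,t)$ is empty. Readers never write data blocks to objects. Reads are visible if $\mathtt{read}$s may perform $\mathtt{update}$s that update meta-data (only) in the shared storage. Regularity: a $\mathtt{read}$ returns the value of either the last $\mathtt{write}$ that returns before the $\mathtt{read}$ is invoked or some $\mathtt{write}$ concurrent with it. Wait-freedom: every operation invoked by a process $p$ returns within a finite number of $p$'s actions (regardless of other processes). **Labels (analysis tool only, not part of the state available to the algorithm).** $\mathbb{W}_v$ is the set of $\mathtt{write}(v)$ operations invoked in runs of the algorithm. Each block $b$ in shared or local storage carries a label set $\mathit{Labels}(b)$. The $k$-th $\mathtt{update}$ event of a $\mathtt{write}$ operation $w$ tags the block it stores (if any) with the unique label $\langle w,k\rangle$, so that block's label set becomes $\{\langle w,k\rangle\}$ (each block in the shared storage pertains to a single write). When a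 reader $p$ obtains a block $b$ from an object $o$ at time $t$ in $r$, the block $b$ in $p.\mathit{data}(r,t+1)$ is tagged with $\mathit{Labels}(o.\mathit{data}(r,t))$; if at a later time $t'$ $p.\mathit{data}$ still contains $b$ and $p$ performs an action on an object $o'$ with $o'.\mathit{data}(r,t')=b$ tagged with label $\ell$, then $\ell$ is added to $\mathit{Labels}(b)$ at $p$. When all copies of $b$ are removed from $p.\mathit{data}$, its labels there are forgotten. For a $\mathtt{write}$ operation $w$, $\mathit{L\text{-}labels}_p(w,r,t)=\big(\bigcup_{b\in p.\mathit{data}(r,t)}\mathit{Labels}(b)\big)\cap(\{w\}\times\mathbb{N})$. **$\tau$-common write (common write $\tau$-disintegrated storage).** The algorithm is $\tau$-common write if whenever a return of $v\in\mathbb{V}$ by a $\mathtt{read}_p$ invocation is enabled at time $t$ in a run $r$, there is $w\in\mathbb{W}_v$ with $|\mathit{L\text{-}labels}_p(w,r,t)|\ge\tau$. *)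

theory Defs
  imports Main "HOL-Library.Extended_Nat" "HOL-Library.Cardinality"
begin

section \<open>Asynchronous shared memory\<close>

text \<open>
  Type variables: \<open>'o\<close> objects, \<open>'p\<close> processes, \<open>'v\<close> register values, \<open>'b\<close> data blocks,
  \<open>'om\<close> and \<open>'pm\<close> meta-data of objects and of processes, \<open>'l\<close> slots of the data array of a process
  (the array holds up to \<open>L = CARD('l)\<close> blocks; an unused slot is \<open>None\<close>).
\<close>

datatype 'v oper = Read | Write 'v

text \<open>\<open>Return (Some v)\<close> is the response of a read, \<open>Return None\<close> the response of a write.\<close>

datatype ('o, 'v) act = Get 'o | Update 'o | Return "'v option"

datatype ('o, 'p, 'v) event = Inv 'p "'v oper" | Do 'p "('o, 'v) act"

record ('b, 'om) ostate =
  odata :: 'b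
  ometa :: 'om

text \<open>
  \<open>pend\<close> is the part of the meta-data of a process that records its pending operation; it is
  changed by invocations and responses only.
\<close>

record ('v, 'b, 'pm, 'l) pstate =
  pdata :: "'l \<Rightarrow> 'b option"
  pmeta :: 'pm
  pend  :: "'v oper option"

record ('o, 'p, 'v, 'b, 'om, 'pm, 'l) config =
  obj  :: "'o \<Rightarrow> ('b, 'om) ostate"
  proc :: "'p \<Rightarrow> ('v, 'b, 'pm, 'l) pstate"

text \<open>
  The transition functions need not be told which object is accessed or which value is returned:
  \<open>next_act\<close> determines this from the process state.

  \<^item> \<open>on_get\<close> yields the new meta-data and the slot, if any, that is overwritten by the object's block;
  \<^item> \<open>on_update\<close> yields the block written to the object, if any, the new meta-data of the object, and
    the new meta-data and data of the process;
  \<^item> \<open>on_return\<close> yields the new meta-data and the slots whose content is kept.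
\<close>

record ('o, 'p, 'v, 'b, 'om, 'pm, 'l) algorithm =
  writer    :: 'p
  inits     :: "('o, 'p, 'v, 'b, 'om, 'pm, 'l) config set"
  init_val  :: 'v
  next_act  :: "'p \<Rightarrow> ('v, 'b, 'pm, 'l) pstate \<Rightarrow> ('o, 'v) act"
  on_invoke :: "'p \<Rightarrow> ('v, 'b, 'pm, 'l) pstate \<Rightarrow> 'v oper \<Rightarrow> 'pm"
  on_get    :: "'p \<Rightarrow> ('v, 'b, 'pm, 'l) pstate \<Rightarrow> ('b, 'om) ostate \<Rightarrow> 'pm \<times> 'l option"
  on_update :: "'p \<Rightarrow> ('v, 'b, 'pm, 'l) pstate \<Rightarrow> ('b, 'om) ostate \<Rightarrow>
                  'b option \<times> 'om \<times> 'pm \<times> ('l \<Rightarrow> 'b option)"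
  on_return :: "'p \<Rightarrow> ('v, 'b, 'pm, 'l) pstate \<Rightarrow> 'pm \<times> 'l set"

definition readers :: "('o, 'p, 'v, 'b, 'om, 'pm, 'l) algorithm \<Rightarrow> 'p set" where
  "readers A = UNIV - {writer A}"

definition storage_cost :: "('o::finite, 'p, 'v, 'b, 'om, 'pm, 'l) algorithm \<Rightarrow> nat" where
  "storage_cost A = CARD('o)"

fun enabled :: "('o, 'p, 'v, 'b, 'om, 'pm, 'l) algorithm \<Rightarrow>
    ('o, 'p, 'v, 'b, 'om, 'pm, 'l) config \<Rightarrow> ('o, 'p, 'v) event \<Rightarrow> bool" where
  "enabled A c (Inv p q) \<longleftrightarrow> pend (proc c p) = None \<and>
     (case q of Read \<Rightarrow> p \<in> readers A | Write v \<Rightarrow> p = writer A)"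
| "enabled A c (Do p a) \<longleftrightarrow> pend (proc c p) \<noteq> None \<and> next_act A p (proc c p) = a"

definition written_block :: "('o, 'p, 'v, 'b, 'om, 'pm, 'l) algorithm \<Rightarrow>
    ('o, 'p, 'v, 'b, 'om, 'pm, 'l) config \<Rightarrow> 'p \<Rightarrow> 'o \<Rightarrow> 'b option" where
  "written_block A c p x = fst (on_update A p (proc c p) (obj c x))"

fun exec :: "('o, 'p, 'v, 'b, 'om, 'pm, 'l) algorithm \<Rightarrow>
    ('o, 'p, 'v, 'b, 'om, 'pm, 'l) config \<Rightarrow> ('o, 'p, 'v) event \<Rightarrow>
    ('o, 'p, 'v, 'b, 'om, 'pm, 'l) config" where
  "exec A c (Inv p q) =
     (let s = proc c p in
      c\<lparr>proc := (proc c)(p := s\<lparr>pmeta := on_invoke A p s q, pend := Some q\<rparr>)\<rparr>)"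
| "exec A c (Do p (Get x)) =
     (let s = proc c p; (m, i) = on_get A p s (obj c x);
          d = (case i of None \<Rightarrow> pdata s | Some j \<Rightarrow> (pdata s)(j := Some (odata (obj c x))))
      in c\<lparr>proc := (proc c)(p := s\<lparr>pmeta := m, pdata := d\<rparr>)\<rparr>)"
| "exec A c (Do p (Update x)) =
     (let s = proc c p; (b, om, m, d) = on_update A p s (obj c x);
          b' = (case b of None \<Rightarrow> odata (obj c x) | Some y \<Rightarrow> y)
      in c\<lparr>obj := (obj c)(x := \<lparr>odata = b', ometa = om\<rparr>),
           proc := (proc c)(p := s\<lparr>pmeta := m, pdata := d\<rparr>)\<rparr>)"
| "exec A c (Do p (Return v)) =
     (let s = proc c p; (m, K) = on_return A p s
      in c\<lparr>proc := (proc c)(p := s\<lparr>pmeta := m, pdata := pdata s |` K, pend := None\<rparr>)\<rparr>)"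

section \<open>Runs and operations\<close>

text \<open>
  The event \<open>ev r t\<close> leads from \<open>conf r t\<close> to \<open>conf r (Suc t)\<close> and exists for \<open>t < len r\<close>;
  \<open>conf r t\<close> is meaningful for \<open>t \<le> len r\<close>.
\<close>

record ('o, 'p, 'v, 'b, 'om, 'pm, 'l) run =
  len  :: enat
  conf :: "nat \<Rightarrow> ('o, 'p, 'v, 'b, 'om, 'pm, 'l) config"
  ev   :: "nat \<Rightarrow> ('o, 'p, 'v) event"

text \<open>
  The last two conjuncts express the initialization: the first operation writes the initial value,
  and no other operation is invoked before it has returned.
\<close>

definition is_run :: "('o, 'p, 'v, 'b, 'om, 'pm, 'l) algorithm \<Rightarrow>
    ('o, 'p, 'v, 'b, 'om, 'pm, 'l) run \<Rightarrow> bool" where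
  "is_run A r \<longleftrightarrow>
     conf r 0 \<in> inits A \<and>
     (\<forall>t. enat t < len r \<longrightarrow>
        enabled A (conf r t) (ev r t) \<and> conf r (Suc t) = exec A (conf r t) (ev r t)) \<and>
     (0 < len r \<longrightarrow> ev r 0 = Inv (writer A) (Write (init_val A))) \<and>
     (\<forall>t p q. 0 < t \<and> enat t < len r \<and> ev r t = Inv p q \<longrightarrow>
        (\<exists>s<t. \<exists>x. ev r s = Do (writer A) (Return x)))"

definition data_blocks :: "('o, 'p, 'v, 'b, 'om, 'pm, 'l) run \<Rightarrow> 'p \<Rightarrow> nat \<Rightarrow> 'b set" where
  "data_blocks r p t = ran (pdata (proc (conf r t) p))"

text \<open>
  An operation of a run is identified with the time of its invocation; \<open>op_returns r i j\<close> says that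
  the operation invoked at time \<open>i\<close> returns at time \<open>j\<close>.
\<close>

definition op_returns :: "('o, 'p, 'v, 'b, 'om, 'pm, 'l) run \<Rightarrow> nat \<Rightarrow> nat \<Rightarrow> bool" where
  "op_returns r i j \<longleftrightarrow> i < j \<and> enat j < len r \<and>
     (\<exists>p q x. ev r i = Inv p q \<and> ev r j = Do p (Return x) \<and>
        (\<forall>k y. i < k \<and> k < j \<longrightarrow> ev r k \<noteq> Do p (Return y)))"

definition concurrent :: "('o, 'p, 'v, 'b, 'om, 'pm, 'l) run \<Rightarrow> nat \<Rightarrow> nat \<Rightarrow> bool" where
  "concurrent r i j \<longleftrightarrow> (\<forall>k. op_returns r i k \<or> op_returns r j k \<longrightarrow> i < k \<and> j < k)"

definition writes_of :: "('o, 'p, 'v, 'b, 'om, 'pm, 'l) algorithm \<Rightarrow>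
    ('o, 'p, 'v, 'b, 'om, 'pm, 'l) run \<Rightarrow> 'v \<Rightarrow> nat set" where
  "writes_of A r v = {w. enat w < len r \<and> ev r w = Inv (writer A) (Write v)}"

definition last_write_before :: "('o, 'p, 'v, 'b, 'om, 'pm, 'l) algorithm \<Rightarrow>
    ('o, 'p, 'v, 'b, 'om, 'pm, 'l) run \<Rightarrow> nat \<Rightarrow> nat \<Rightarrow> bool" where
  "last_write_before A r i w \<longleftrightarrow> w \<in> (\<Union>v. writes_of A r v) \<and>
     (\<exists>k<i. op_returns r w k \<and>
        (\<forall>w' \<in> (\<Union>v. writes_of A r v). \<forall>k'<i. op_returns r w' k' \<longrightarrow> k' \<le> k))"

section \<open>Register emulations\<close>

text \<open>
  Restrictions on what the processes may do are imposed on reachable states only.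
\<close>

definition register_emulation :: "('o, 'p, 'v, 'b, 'om, 'pm, 'l) algorithm \<Rightarrow> bool" where
  "register_emulation A \<longleftrightarrow>
     inits A \<noteq> {} \<and>
     (\<forall>c \<in> inits A. \<forall>p. pend (proc c p) = None) \<and>
     (\<forall>r t. is_run A r \<and> enat t < len r \<longrightarrow>
        (\<forall>p. ev r t = Inv p Read \<longrightarrow> data_blocks r p t = {}) \<and>
        (\<forall>p \<in> readers A. \<forall>x. ev r t = Do p (Update x) \<longrightarrow> written_block A (conf r t) p x = None) \<and>
        (\<forall>p v. ev r t = Do p (Return v) \<longrightarrow>
           (v \<noteq> None \<longleftrightarrow> pend (proc (conf r t) p) = Some Read)))"

definition regular :: "('o, 'p, 'v, 'b, 'om, 'pm, 'l) algorithm \<Rightarrow> bool" where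
  "regular A \<longleftrightarrow> (\<forall>r i j p v.
     is_run A r \<and> ev r i = Inv p Read \<and> op_returns r i j \<and> ev r j = Do p (Return (Some v)) \<longrightarrow>
     (\<exists>w \<in> writes_of A r v. last_write_before A r i w \<or> concurrent r w i))"

definition wait_free :: "('o, 'p, 'v, 'b, 'om, 'pm, 'l) algorithm \<Rightarrow> bool" where
  "wait_free A \<longleftrightarrow> (\<forall>r i p q.
     is_run A r \<and> len r = \<infinity> \<and> ev r i = Inv p q \<and> infinite {t. \<exists>a. ev r t = Do p a} \<longrightarrow>
     (\<exists>j. op_returns r i j))"

section \<open>Labels\<close>

text \<open>The label \<open>(w, k)\<close> stands for the \<open>k\<close>-th update event of the operation invoked at time \<open>w\<close>.\<close>

type_synonym label = "nat \<times> nat"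

definition current_op :: "('o, 'p, 'v, 'b, 'om, 'pm, 'l) run \<Rightarrow> 'p \<Rightarrow> nat \<Rightarrow> nat" where
  "current_op r p t = Max {s. s < t \<and> (\<exists>q. ev r s = Inv p q)}"

definition update_label :: "('o, 'p, 'v, 'b, 'om, 'pm, 'l) run \<Rightarrow> 'p \<Rightarrow> nat \<Rightarrow> label" where
  "update_label r p t =
     (let w = current_op r p t
      in (w, card {s. w < s \<and> s \<le> t \<and> (\<exists>x. ev r s = Do p (Update x))}))"

fun obj_labels :: "('o, 'p, 'v, 'b, 'om, 'pm, 'l) algorithm \<Rightarrow>
    ('o, 'p, 'v, 'b, 'om, 'pm, 'l) run \<Rightarrow> 'o \<Rightarrow> nat \<Rightarrow> label set" where
  "obj_labels A r x 0 = {}"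
| "obj_labels A r x (Suc t) =
     (if \<exists>p. ev r t = Do p (Update x) \<and> written_block A (conf r t) p x \<noteq> None
      then {update_label r p t | p. ev r t = Do p (Update x)}
      else obj_labels A r x t)"

definition accesses :: "('o, 'p, 'v, 'b, 'om, 'pm, 'l) run \<Rightarrow> 'p \<Rightarrow> 'o \<Rightarrow> nat \<Rightarrow> bool" where
  "accesses r p x t \<longleftrightarrow> ev r t = Do p (Get x) \<or> ev r t = Do p (Update x)"

text \<open>
  \<open>proc_labels A r p b t\<close> is the label set of \<open>b\<close> in the local data of \<open>p\<close> at time \<open>t\<close>. If \<open>b\<close> is absent
  at time \<open>t\<close>, its label set there is empty, so that the second case covers both a block being
  obtained at time \<open>t\<close> and a block that is met again while still present.
\<close>

fun proc_labels :: "('o, 'p, 'v, 'b, 'om, 'pm, 'l) algorithm \<Rightarrow>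
    ('o, 'p, 'v, 'b, 'om, 'pm, 'l) run \<Rightarrow> 'p \<Rightarrow> 'b \<Rightarrow> nat \<Rightarrow> label set" where
  "proc_labels A r p b 0 = {}"
| "proc_labels A r p b (Suc t) =
     (if b \<notin> data_blocks r p (Suc t) then {}
      else proc_labels A r p b t \<union>
        (\<Union>x \<in> {x. accesses r p x t \<and> odata (obj (conf r t) x) = b}. obj_labels A r x t))"

definition L_labels :: "('o, 'p, 'v, 'b, 'om, 'pm, 'l) algorithm \<Rightarrow>
    ('o, 'p, 'v, 'b, 'om, 'pm, 'l) run \<Rightarrow> 'p \<Rightarrow> nat \<Rightarrow> nat \<Rightarrow> label set" where
  "L_labels A r p w t = (\<Union>b \<in> data_blocks r p t. proc_labels A r p b t) \<inter> ({w} \<times> UNIV)"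

definition common_write :: "nat \<Rightarrow> ('o, 'p, 'v, 'b, 'om, 'pm, 'l) algorithm \<Rightarrow> bool" where
  "common_write \<tau> A \<longleftrightarrow> (\<forall>r t p v.
     is_run A r \<and> enat t \<le> len r \<and> pend (proc (conf r t) p) = Some Read \<and>
     enabled A (conf r t) (Do p (Return (Some v))) \<longrightarrow>
     (\<exists>w \<in> writes_of A r v. \<tau> \<le> card (L_labels A r p w t)))"

end

(*
  A reader pending forever can pin tau - 1 blocks of one write in the storage. Schedule the writer
  against a reader p so that p never meets a second label of a write that can still supply tau labels
  in total (those p already has plus those in the storage). If this could go on forever, p would never
  return, against wait-freedom; so at some point the schedule fails at a write w, and then w keeps at
  least tau - 1 blocks in the storage as long as p makes no step. Repeating this with fresh readers,
  while no longer writing the values already pinned (regularity keeps later readers from returning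
  them), pins one value per reader. With two values u1, u2 and one reader left, write u1 and then u2:
  after each step of the second write the reader could run alone, hence tau blocks of a write of u1 or
  of u2 are stored. Each step changes one block only, so at the moment of transition there are tau
  blocks for one value and at least tau - 1 for the other.
*)

theory Submission
  imports Defs
begin

section \<open>Events and labels\<close>

fun who :: "('o, 'p, 'v) event \<Rightarrow> 'p" where
  "who (Inv p q) = p"
| "who (Do p a) = p"

lemma proc_exec_other: "who e \<noteq> p \<Longrightarrow> proc (exec A c e) p = proc c p"
  by (cases "(A, c, e)" rule: exec.cases) (auto simp: Let_def split: prod.splits)

lemma pend_exec:
  "pend (proc (exec A c e) p) =
    (case e of Inv p' q \<Rightarrow> if p' = p then Some q else pend (proc c p)
     | Do p' a \<Rightarrow> if p' = p \<and> (\<exists>y. a = Return y) then None else pend (proc c p))"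
  by (cases "(A, c, e)" rule: exec.cases) (auto simp: Let_def split: prod.splits)

text \<open>Labels depend on the past only, so the labels of a list of events can be compared with
  those of its extensions.\<close>

lemma obj_labels_cong:
  assumes "\<And>s. s < t \<Longrightarrow> ev r s = ev r' s" "\<And>s. s < t \<Longrightarrow> conf r s = conf r' s"
  shows "obj_labels A r x t = obj_labels A r' x t"
  using assms
proof (induction t)
  case (Suc t)
  have "current_op r p t = current_op r' p t" for p
    unfolding current_op_def using Suc.prems(1) by (intro arg_cong[where f = Max]) auto
  moreover have "{s. w < s \<and> s \<le> t \<and> (\<exists>x. ev r s = Do p (Update x))} =
      {s. w < s \<and> s \<le> t \<and> (\<exists>x. ev r' s = Do p (Update x))}" for p w
    using Suc.prems(1) by auto
  ultimately have "update_label r p t = update_label r' p t" for p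
    by (simp add: update_label_def Let_def)
  moreover have "obj_labels A r x t = obj_labels A r' x t"
    using Suc by simp
  ultimately show ?case
    using Suc.prems(1)[of t] Suc.prems(2)[of t] by (auto simp del: not_None_eq)
qed simp

lemma proc_labels_cong:
  assumes "\<And>s. s < t \<Longrightarrow> ev r s = ev r' s" "\<And>s. s \<le> t \<Longrightarrow> conf r s = conf r' s"
  shows "proc_labels A r p b t = proc_labels A r' p b t"
  using assms
proof (induction t)
  case (Suc t)
  have "obj_labels A r x t = obj_labels A r' x t" for x
    using Suc.prems by (intro obj_labels_cong) auto
  moreover have "accesses r p x t \<longleftrightarrow> accesses r' p x t" for x
    using Suc.prems(1)[of t] by (simp add: accesses_def)
  moreover have "proc_labels A r p b t = proc_labels A r' p b t"
    using Suc by simp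
  ultimately show ?case
    using Suc.prems(2)[of t] Suc.prems(2)[of "Suc t"] by (simp add: data_blocks_def)
qed simp

section \<open>Finite runs as event lists\<close>

locale emulation =
  fixes A :: "('o::finite, 'p::finite, 'v::finite, 'b, 'om, 'pm, 'l::finite) algorithm"
    and \<tau> :: nat
    and c0 :: "('o, 'p, 'v, 'b, 'om, 'pm, 'l) config"
  assumes tau: "\<tau> > 1"
    and emulation: "register_emulation A"
    and regular: "regular A"
    and wait_free: "wait_free A"
    and common: "common_write \<tau> A"
    and init: "c0 \<in> inits A"
begin

abbreviation "wrt \<equiv> writer A"

text \<open>Transitions are deterministic, so a finite run from the fixed \<open>c0\<close> is
  determined by its events, and schedules can be built and extended as lists.\<close>

definition cfg where "cfg es = fold (\<lambda>e c. exec A c e) es c0"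

definition run_of :: "('o, 'p, 'v) event list \<Rightarrow> ('o, 'p, 'v, 'b, 'om, 'pm, 'l) run" where
  "run_of es = \<lparr>len = enat (length es), conf = (\<lambda>t. cfg (take t es)), ev = (\<lambda>t. es ! t)\<rparr>"

abbreviation "valid es \<equiv> is_run A (run_of es)"

abbreviation "pending es p \<equiv> pend (proc (cfg es) p)"

abbreviation "initialized es \<equiv> \<exists>y. Do wrt (Return y) \<in> set es"

definition writes where "writes es v = writes_of A (run_of es) v"

definition olabels where "olabels es x = obj_labels A (run_of es) x (length es)"

definition llabels where "llabels es p w = L_labels A (run_of es) p w (length es)"

text \<open>In a valid run each object carries at most one label, so the cardinality of this set
  never exceeds the number of objects holding a block of \<open>w\<close>.\<close>

definition stored where "stored es w = (\<Union>x. olabels es x) \<inter> ({w} \<times> UNIV)"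

section \<open>Validity of event lists and pending operations\<close>

lemma cfg_Nil [simp]: "cfg [] = c0"
  by (simp add: cfg_def)

lemma cfg_snoc [simp]: "cfg (es @ [e]) = exec A (cfg es) e"
  by (simp add: cfg_def)

lemma run_of_simps [simp]:
  "len (run_of es) = enat (length es)" "conf (run_of es) t = cfg (take t es)"
  "ev (run_of es) t = es ! t"
  by (simp_all add: run_of_def)

lemma in_writes: "w \<in> writes es v \<longleftrightarrow> w < length es \<and> es ! w = Inv wrt (Write v)"
  by (simp add: writes_def writes_of_def)

lemma writes_append: "w \<in> writes es v \<Longrightarrow> w \<in> writes (es @ fs) v"
  by (simp add: in_writes nth_append)

lemma initialized_take:
  "t \<le> length es \<Longrightarrow> initialized (take t es) \<longleftrightarrow> (\<exists>s<t. \<exists>x. es ! s = Do wrt (Return x))"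
  by (auto simp: in_set_conv_nth) (metis nth_take)

text \<open>The equation between successive configurations holds by construction of
  \<open>cfg\<close>; enabledness and the two conditions on the initialization remain.\<close>

lemma valid_iff:
  "valid es \<longleftrightarrow> (\<forall>t < length es. enabled A (cfg (take t es)) (es ! t)) \<and>
     (es \<noteq> [] \<longrightarrow> es ! 0 = Inv wrt (Write (init_val A))) \<and>
     (\<forall>t p q. 0 < t \<and> t < length es \<and> es ! t = Inv p q \<longrightarrow> initialized (take t es))"
  using init by (simp add: is_run_def take_Suc_conv_app_nth initialized_take zero_enat_def cong: conj_cong)

lemma valid_Nil: "valid []"
  by (simp add: valid_iff)

lemma valid_snoc:
  "valid (es @ [e]) \<longleftrightarrow> valid es \<and> enabled A (cfg es) e \<and>
     (if es = [] then e = Inv wrt (Write (init_val A)) else (\<forall>p q. e = Inv p q \<longrightarrow> initialized es))"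
  unfolding valid_iff
  by (auto simp: nth_append less_Suc_eq Suc_le_eq split: if_splits)

lemma valid_append: "valid (es @ fs) \<Longrightarrow> valid es"
proof (induction fs rule: rev_induct)
  case (snoc e fs)
  then show ?case
    using valid_snoc[of "es @ fs" e] by auto
qed simp

lemma valid_hd: "valid es \<Longrightarrow> es \<noteq> [] \<Longrightarrow> es ! 0 = Inv wrt (Write (init_val A))"
  by (simp add: valid_iff)

lemma pending_Nil [simp]: "pend (proc c0 p) = None"
  using emulation init by (simp add: register_emulation_def)

lemma proc_cfg_append:
  assumes "\<And>e. e \<in> set fs \<Longrightarrow> who e \<noteq> p"
  shows "proc (cfg (es @ fs)) p = proc (cfg es) p"
  using assms
proof (induction fs rule: rev_induct)
  case (snoc e fs)
  have "proc (cfg ((es @ fs) @ [e])) p = proc (cfg (es @ fs)) p"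
    using snoc.prems by (simp only: cfg_snoc) (intro proc_exec_other, simp)
  then show ?case
    using snoc by simp
qed simp

lemma pending_snoc:
  "pending (es @ [e]) p =
    (case e of Inv p' q \<Rightarrow> if p' = p then Some q else pending es p
     | Do p' a \<Rightarrow> if p' = p \<and> (\<exists>y. a = Return y) then None else pending es p)"
  by (simp add: pend_exec)

lemma pending_stay:
  assumes "valid (es @ fs)" "pending es p = Some q" "\<And>y. Do p (Return y) \<notin> set fs"
  shows "pending (es @ fs) p = Some q"
  using assms
proof (induction fs rule: rev_induct)
  case (snoc e fs)
  have v: "valid (es @ fs)" "enabled A (cfg (es @ fs)) e"
    using snoc.prems(1) valid_snoc[of "es @ fs" e] by auto
  with snoc have "pending (es @ fs) p = Some q"
    by simp
  moreover have "e \<noteq> Do p (Return y)" for y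
    using snoc.prems(3)[of y] by auto
  ultimately show ?case
    using v(2) pending_snoc[of "es @ fs" e p] by (auto split: event.splits)
qed simp

lemma pending_invoked:
  assumes "valid es" "pending es p = Some q"
  shows "\<exists>i<length es. es ! i = Inv p q \<and> (\<forall>j y. i < j \<and> j < length es \<longrightarrow> es ! j \<noteq> Do p (Return y))"
  using assms
proof (induction es rule: rev_induct)
  case (snoc e es)
  show ?case
  proof (cases "\<exists>q'. e = Inv p q'")
    case True
    then show ?thesis
      using snoc.prems(2) pending_snoc[of es e p] by (intro exI[of _ "length es"]) auto
  next
    case False
    then have *: "\<And>y. e \<noteq> Do p (Return y)" "pending es p = Some q"
      using snoc.prems(2) pending_snoc[of es e p] by (auto split: event.splits if_splits)
    then obtain i where "i < length es" "es ! i = Inv p q"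
      "\<forall>j y. i < j \<and> j < length es \<longrightarrow> es ! j \<noteq> Do p (Return y)"
      using snoc valid_append by blast
    then show ?thesis
      using * by (intro exI[of _ i]) (auto simp: nth_append less_Suc_eq)
  qed
qed simp

lemma idle_returned:
  assumes "valid es" "pending es p = None" "i < length es" "es ! i = Inv p q"
  shows "\<exists>k y. i < k \<and> k < length es \<and> es ! k = Do p (Return y)"
proof (rule ccontr)
  assume no: "\<not> ?thesis"
  have "pending (take (Suc i) es) p = Some q"
    using assms(3,4) pending_snoc[of "take i es" "es ! i" p] by (simp add: take_Suc_conv_app_nth)
  moreover have "Do p (Return y) \<notin> set (drop (Suc i) es)" for y
    using no by (force simp: in_set_conv_nth)
  ultimately have "pending es p = Some q"
    using pending_stay[of "take (Suc i) es" "drop (Suc i) es" p q] assms(1) by simp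
  then show False
    using assms(2) by simp
qed

lemma op_returns_first:
  assumes "es ! i = Inv p q" "i < k" "k < length es" "es ! k = Do p (Return y)"
  shows "\<exists>k'\<le>k. op_returns (run_of es) i k'"
proof -
  \<comment> \<open>\<open>op_returns\<close> admits only the first response after the invocation,
    hence the least index.\<close>
  define k' where "k' = (LEAST k. i < k \<and> (\<exists>y. es ! k = Do p (Return y)))"
  have k: "i < k \<and> (\<exists>y. es ! k = Do p (Return y))"
    using assms(2,4) by blast
  have k': "i < k' \<and> (\<exists>y. es ! k' = Do p (Return y))" "k' \<le> k"
    unfolding k'_def by (rule LeastI, rule k) (rule Least_le, rule k)
  have "es ! j \<noteq> Do p (Return z)" if "i < j" "j < k'" for j z
    using not_less_Least[of j] that unfolding k'_def by blast
  then have "op_returns (run_of es) i k'"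
    using k' assms(1,3) by (auto simp: op_returns_def)
  then show ?thesis
    using k'(2) by blast
qed

subsection \<open>Evolution of the labels\<close>

lemma olabels_snoc:
  "olabels (es @ [e]) x =
    (if \<exists>p. e = Do p (Update x) \<and> written_block A (cfg es) p x \<noteq> None
     then {update_label (run_of (es @ [e])) p (length es) | p. e = Do p (Update x)} else olabels es x)"
proof -
  have "obj_labels A (run_of (es @ [e])) x (length es) = olabels es x"
    unfolding olabels_def by (rule obj_labels_cong) (auto simp: nth_append)
  then show ?thesis
    by (auto simp: olabels_def simp del: not_None_eq)
qed

lemma llabels_snoc:
  "llabels (es @ [e]) p w \<subseteq> llabels es p w \<union>
    (\<Union>x \<in> {x. e = Do p (Get x) \<or> e = Do p (Update x)}. olabels es x \<inter> ({w} \<times> UNIV))"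
proof -
  have O: "obj_labels A (run_of (es @ [e])) x (length es) = olabels es x" for x
    unfolding olabels_def by (rule obj_labels_cong) (auto simp: nth_append)
  have P: "proc_labels A (run_of (es @ [e])) p b (length es) = proc_labels A (run_of es) p b (length es)" for b
    by (rule proc_labels_cong) (auto simp: nth_append)
  \<comment> \<open>A block obtained in this step had no labels before, so its old label set adds
    nothing to \<open>llabels es p w\<close>.\<close>
  have absent: "proc_labels A r p b t = {}" if "b \<notin> data_blocks r p t" for r b t
    using that by (cases t) auto
  show ?thesis
    unfolding llabels_def L_labels_def
    using absent[of _ "run_of es" "length es"]
    by (fastforce simp: O P accesses_def nth_append split: if_splits)
qed

lemma reader_writes_nothing:
  assumes "valid (es @ [Do p (Update x)])" "p \<noteq> wrt"
  shows "written_block A (cfg es) p x = None"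
proof -
  have "ev (run_of (es @ [Do p (Update x)])) (length es) = Do p (Update x)"
    "enat (length es) < len (run_of (es @ [Do p (Update x)]))"
    by simp_all
  then show ?thesis
    using emulation assms unfolding register_emulation_def readers_def
    by (fastforce simp: nth_append)
qed

text \<open>Readers store no blocks, so only the writer relabels objects, and a new label names its
  latest invocation.\<close>

lemma olabels_snoc_cases:
  assumes "valid (es @ [e])"
  shows "olabels (es @ [e]) x = olabels es x \<or>
    who e = wrt \<and> (\<exists>w k. olabels (es @ [e]) x = {(w, k)} \<and> w < length es \<and>
      (\<forall>s q. s < length es \<and> es ! s = Inv wrt q \<longrightarrow> s \<le> w))"
proof (cases "\<exists>p. e = Do p (Update x) \<and> written_block A (cfg es) p x \<noteq> None")
  case True
  then obtain p where p: "e = Do p (Update x)" "written_block A (cfg es) p x \<noteq> None"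
    by blast
  then have "p = wrt"
    using assms reader_writes_nothing[of es p x] by (cases "p = wrt") auto
  \<comment> \<open>\<open>current_op\<close> is the maximum of these indices; index 0, the
    initializing write, shows that the set is nonempty.\<close>
  let ?S = "{s. s < length es \<and> (\<exists>q. (es @ [e]) ! s = Inv wrt q)}"
  have "enabled A (cfg es) e"
    using assms valid_snoc by blast
  then have "es \<noteq> []"
    using p by auto
  then have "0 \<in> ?S"
    using valid_hd valid_append[OF assms] by (auto simp: nth_append)
  then have "Max ?S \<in> ?S"
    by (intro Max_in) auto
  moreover have "s \<le> Max ?S" if "s < length es" "es ! s = Inv wrt q" for s q
    using that by (intro Max_ge) (auto simp: nth_append)
  moreover obtain k where "olabels (es @ [e]) x = {(Max ?S, k)}"
    using p \<open>p = wrt\<close> by (auto simp: olabels_snoc update_label_def current_op_def Let_def)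
  ultimately show ?thesis
    using p \<open>p = wrt\<close> by auto
next
  case False
  then show ?thesis
    using olabels_snoc by auto
qed

lemma olabels_Nil [simp]: "olabels [] x = {}"
  by (simp add: olabels_def)

lemma llabels_Nil [simp]: "llabels [] p w = {}"
  by (simp add: llabels_def L_labels_def)

lemma olabels_cases:
  "valid es \<Longrightarrow> olabels es x = {} \<or> (\<exists>w k. olabels es x = {(w, k)} \<and> w < length es)"
proof (induction es rule: rev_induct)
  case (snoc e es)
  then show ?case
    using olabels_snoc_cases[of es e x] valid_append[of es "[e]"] by fastforce
qed simp

lemma llabels_bound: "valid es \<Longrightarrow> finite (llabels es p w) \<and> (w \<ge> length es \<longrightarrow> llabels es p w = {})"
proof (induction es rule: rev_induct)
  case (snoc e es)
  have v: "valid es"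
    using snoc.prems valid_append by blast
  have fin: "finite (olabels es x)" "w \<ge> length es \<Longrightarrow> olabels es x \<inter> ({w} \<times> UNIV) = {}" for x
    using olabels_cases[OF v, of x] by auto
  have "finite (llabels (es @ [e]) p w)"
    using snoc.IH[OF v] fin by (intro finite_subset[OF llabels_snoc]) auto
  moreover have "llabels (es @ [e]) p w = {}" if "w \<ge> length (es @ [e])"
    using snoc.IH[OF v] fin(2) that llabels_snoc[of es e p w] by auto
  ultimately show ?case
    by blast
qed simp

lemma llabels_append:
  assumes "\<And>e. e \<in> set fs \<Longrightarrow> who e \<noteq> p"
  shows "llabels (es @ fs) p w \<subseteq> llabels es p w"
  using assms
proof (induction fs rule: rev_induct)
  case (snoc e fs)
  have "e \<noteq> Do p a" for a
    using snoc.prems[of e] by auto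
  then have "llabels ((es @ fs) @ [e]) p w \<subseteq> llabels (es @ fs) p w"
    using llabels_snoc[of "es @ fs" e p w] by auto
  then show ?case
    using snoc by simp
qed simp

lemma olabels_readers:
  assumes "valid (es @ fs)" "\<And>e. e \<in> set fs \<Longrightarrow> who e \<noteq> wrt"
  shows "olabels (es @ fs) x = olabels es x"
  using assms
proof (induction fs rule: rev_induct)
  case (snoc e fs)
  have "olabels ((es @ fs) @ [e]) x = olabels (es @ fs) x"
    using snoc.prems olabels_snoc_cases[of "es @ fs" e x] by simp
  then show ?case
    using snoc valid_append[of "es @ fs" "[e]"] by simp
qed simp

text \<open>Once idle, the writer must invoke a new operation before it can store a block, so a
  changed label names an operation invoked after \<open>es\<close>. The list \<open>fs\<close>
  allows a comparison with a later moment than the idle one.\<close>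

lemma olabels_idle:
  assumes "valid (es @ fs @ gs)" "pending es wrt = None"
  shows "olabels (es @ fs @ gs) x = olabels (es @ fs) x \<or> (\<forall>l \<in> olabels (es @ fs @ gs) x. length es \<le> fst l)"
  using assms
proof (induction gs rule: rev_induct)
  case (snoc e gs)
  let ?E = "es @ fs @ gs"
  have v: "valid (?E @ [e])" "valid ?E"
    using snoc.prems(1) valid_append[of ?E "[e]"] by simp_all
  show ?case
  proof (cases "olabels (?E @ [e]) x = olabels ?E x")
    case True
    then show ?thesis
      using snoc v by simp
  next
    case False
    then obtain w k where w: "who e = wrt" "olabels (?E @ [e]) x = {(w, k)}"
      "\<And>s q. s < length ?E \<Longrightarrow> ?E ! s = Inv wrt q \<Longrightarrow> s \<le> w"
      using olabels_snoc_cases[OF v(1), of x] by blast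
    have "\<exists>a. e = Do wrt a"
      using False w(1) olabels_snoc[of ?E e x] by (cases e) (auto split: if_splits)
    then obtain q where q: "pending ?E wrt = Some q"
      using v(1) valid_snoc[of ?E e] by auto
    obtain i where i: "i < length ?E" "?E ! i = Inv wrt q"
      "\<And>j y. i < j \<Longrightarrow> j < length ?E \<Longrightarrow> ?E ! j \<noteq> Do wrt (Return y)"
      using pending_invoked[OF v(2) q] by blast
    \<comment> \<open>The pending invocation cannot lie in \<open>es\<close>, where every invocation
      of the writer has been answered.\<close>
    have "length es \<le> i"
    proof (rule ccontr)
      assume "\<not> length es \<le> i"
      then obtain k' y where "i < k'" "k' < length es" "es ! k' = Do wrt (Return y)"
        using idle_returned[of es wrt i q] i(2) snoc.prems(2) valid_append[of es "fs @ gs"] v(2)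
        by (auto simp: nth_append)
      then show False
        using i(3)[of k' y] by (simp add: nth_append)
    qed
    then show ?thesis
      using w(2) w(3)[OF i(1,2)] by simp
  qed
qed simp

text \<open>Labels of an operation that is over can only be overwritten: whatever the writer stores
  later belongs to later operations.\<close>

lemma stored_idle:
  assumes "valid (es @ fs @ gs)" "pending es wrt = None" "w < length es"
  shows "stored (es @ fs @ gs) w \<subseteq> stored (es @ fs) w"
  using olabels_idle[OF assms(1,2)] assms(3) unfolding stored_def by fastforce

lemma stored_readers:
  assumes "valid (es @ fs)" "\<And>e. e \<in> set fs \<Longrightarrow> who e \<noteq> wrt"
  shows "stored (es @ fs) w = stored es w"
  using olabels_readers[OF assms] by (simp add: stored_def)

lemma finite_stored:
  assumes "valid es"
  shows "finite (stored es w)"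
proof -
  have "finite (olabels es x)" for x
    using olabels_cases[OF assms, of x] by auto
  then show ?thesis
    by (simp add: stored_def)
qed

subsection \<open>Consequences of wait-freedom and regularity\<close>

text \<open>This turns wait-freedom, a statement about infinite runs, into one about finite lists:
  iterating the extension yields an infinite run in which \<open>p\<close> acts infinitely often
  while its pending operation never returns.\<close>

lemma progress:
  assumes "Q es" and valid: "\<And>es. Q es \<Longrightarrow> valid es"
    and step: "\<And>es. Q es \<Longrightarrow>
      \<exists>fs. Q (es @ fs) \<and> (\<exists>a. Do p a \<in> set fs) \<and> (\<forall>y. Do p (Return y) \<notin> set fs)"
    and pending: "pending es p = Some q"
  shows False
proof -
  obtain i where i: "i < length es" "es ! i = Inv p q"
    "\<And>j y. i < j \<Longrightarrow> j < length es \<Longrightarrow> es ! j \<noteq> Do p (Return y)"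
    using pending_invoked[OF valid[OF assms(1)] pending] by blast
  obtain g where g: "\<And>es. Q es \<Longrightarrow> Q (es @ g es)" "\<And>es. Q es \<Longrightarrow> \<exists>a. Do p a \<in> set (g es)"
    "\<And>es y. Q es \<Longrightarrow> Do p (Return y) \<notin> set (g es)"
    using step by metis
  define E where "E k = ((\<lambda>es. es @ g es) ^^ k) es" for k
  have E: "E 0 = es" "E (Suc k) = E k @ g (E k)" for k
    by (simp_all add: E_def)
  have Q: "Q (E k)" for k
    by (induction k) (use assms(1) g(1) E in auto)
  have prefix: "\<exists>hs. E k = E j @ hs \<and> (\<forall>y. Do p (Return y) \<notin> set hs)" if "j \<le> k" for j k
    using that
  proof (induction k rule: dec_induct)
    case (step k)
    then show ?case
      using E(2)[of k] g(3)[OF Q[of k]] by auto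
  qed simp
  have long: "k \<le> length (E k)" for k
  proof (induction k)
    case (Suc k)
    then show ?case
      using E(2)[of k] g(2)[OF Q[of k]] by (cases "g (E k)") auto
  qed simp
  \<comment> \<open>The lists \<open>E k\<close> extend one another and \<open>E (Suc t)\<close> is
    longer than \<open>t\<close>, so its position \<open>t\<close> gives the event of the limit
    run.\<close>
  define f where "f t = E (Suc t) ! t" for t
  have f: "E k ! t = f t" if "t < length (E k)" for k t
    unfolding f_def using prefix[of k "Suc t"] prefix[of "Suc t" k] that long[of "Suc t"]
    by (cases "k \<le> Suc t") (auto simp: nth_append)
  have map_f: "map f [0..<n] = take n (E k)" if "n \<le> length (E k)" for n k
    using that f by (intro nth_equalityI) auto
  define r :: "('o, 'p, 'v, 'b, 'om, 'pm, 'l) run"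
    where "r = \<lparr>len = \<infinity>, conf = (\<lambda>t. cfg (map f [0..<t])), ev = f\<rparr>"
  have r: "len r = \<infinity>" "ev r = f" "t \<le> length (E k) \<Longrightarrow> conf r t = conf (run_of (E k)) t" for t k
    by (simp_all add: r_def map_f)
  have "is_run A r"
    unfolding is_run_def
  proof (intro conjI allI impI)
    show "conf r 0 \<in> inits A"
      using init by (simp add: r_def)
  next
    fix t
    have "Suc t \<le> length (E (Suc t))" "valid (E (Suc t))"
      using long Q valid by blast+
    then show "enabled A (conf r t) (ev r t)" "conf r (Suc t) = exec A (conf r t) (ev r t)"
      using r(3)[of t "Suc t"] r(3)[of "Suc t" "Suc t"]
      by (simp_all add: is_run_def r(2) f)
  next
    show "ev r 0 = Inv wrt (Write (init_val A))"
      using valid_hd[OF valid[OF Q[of 0]]] i(1) f[of 0 0] by (cases "E 0 = []") (auto simp: r(2) E(1))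
  next
    fix t p q
    assume t: "0 < t \<and> enat t < len r \<and> ev r t = Inv p q"
    have *: "Suc t \<le> length (E (Suc t))" "valid (E (Suc t))"
      using long Q valid by blast+
    then have "E (Suc t) ! t = Inv p q"
      using t f by (simp add: r(2))
    then have "initialized (take t (E (Suc t)))"
      using * t unfolding valid_iff by (meson Suc_le_lessD)
    then obtain s x where "s < t" "E (Suc t) ! s = Do wrt (Return x)"
      using * by (auto simp: initialized_take)
    then show "\<exists>s<t. \<exists>x. ev r s = Do wrt (Return x)"
      using f[of s "Suc t"] * by (auto simp: r(2))
  qed
  moreover have "ev r i = Inv p q"
    using i f[of i 0] E(1) by (simp add: r(2))
  moreover have "infinite {t. \<exists>a. ev r t = Do p a}"
    unfolding infinite_nat_iff_unbounded_le
  proof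
    fix m
    obtain j a where "j < length (g (E m))" "g (E m) ! j = Do p a"
      using g(2)[OF Q[of m]] by (auto simp: in_set_conv_nth)
    then have "f (length (E m) + j) = Do p a"
      using f[of "length (E m) + j" "Suc m"] E(2)[of m] by simp
    then show "\<exists>n\<ge>m. n \<in> {t. \<exists>a. ev r t = Do p a}"
      using long[of m] r(2) by (intro exI[of _ "length (E m) + j"]) auto
  qed
  ultimately obtain j where j: "op_returns r i j"
    using wait_free r(1) unfolding wait_free_def by blast
  then obtain y where y: "i < j" "f j = Do p (Return y)"
    using \<open>ev r i = Inv p q\<close> by (auto simp: op_returns_def r(2))
  \<comment> \<open>The response at time \<open>j\<close> already occurs in
    \<open>E (Suc j)\<close>: either in \<open>es\<close>, where the operation is still pending at
    the end, or in an added segment, none of which contains a response of \<open>p\<close>.\<close>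
  obtain hs where hs: "E (Suc j) = es @ hs" "Do p (Return y) \<notin> set hs"
    using prefix[of 0 "Suc j"] E(1) by auto
  have "j < length (es @ hs)" "(es @ hs) ! j = Do p (Return y)"
    using y f[of j "Suc j"] long[of "Suc j"] hs by auto
  then show False
    using i(3)[OF y(1), of y] hs(2)
    by (cases "j < length es") (auto simp: nth_append in_set_conv_nth)
qed

text \<open>Let \<open>p\<close> run alone. While its operation is pending some action is enabled,
  so never meeting a response would contradict \<open>progress\<close>.\<close>

lemma solo_completes:
  assumes "valid es" "pending es p \<noteq> None"
  shows "\<exists>fs y. valid (es @ fs @ [Do p (Return y)]) \<and>
    (\<forall>e \<in> set fs. \<exists>a. e = Do p a \<and> (\<forall>y. a \<noteq> Return y))"
proof (rule ccontr)
  assume no: "\<not> ?thesis"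
  obtain q where q: "pending es p = Some q"
    using assms(2) by blast
  define Q where "Q E \<longleftrightarrow> (\<exists>fs. E = es @ fs \<and> valid E \<and>
    (\<forall>e \<in> set fs. \<exists>a. e = Do p a \<and> (\<forall>y. a \<noteq> Return y)))" for E
  show False
  proof (rule progress[of Q es p q])
    show "Q es"
      using assms(1) by (simp add: Q_def)
    show "valid E" if "Q E" for E
      using that by (auto simp: Q_def)
    show "pending es p = Some q"
      by (rule q)
    fix E
    assume "Q E"
    then obtain fs where fs: "E = es @ fs" "valid E" "\<forall>e \<in> set fs. \<exists>a. e = Do p a \<and> (\<forall>y. a \<noteq> Return y)"
      by (auto simp: Q_def)
    have pE: "pending E p = Some q"
      using fs by (auto intro!: pending_stay[OF _ q])
    define a where "a = next_act A p (proc (cfg E) p)"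
    have "E \<noteq> []"
      using pE by auto
    then have v: "valid (E @ [Do p a])"
      using fs(2) pE by (simp add: valid_snoc a_def)
    have "a \<noteq> Return y" for y
    proof
      assume "a = Return y"
      then have "valid (es @ fs @ [Do p (Return y)])"
        using v fs(1) by simp
      then show False
        using no fs(3) by blast
    qed
    then show "\<exists>gs. Q (E @ gs) \<and> (\<exists>a. Do p a \<in> set gs) \<and> (\<forall>y. Do p (Return y) \<notin> set gs)"
      using v fs unfolding Q_def by (intro exI[of _ "[Do p a]"]) auto
  qed
qed

text \<open>The processes finish one after the other, each running alone; those already idle take no
  step and stay idle.\<close>

lemma quiesce:
  assumes "valid es" "finite S"
  shows "\<exists>fs. valid (es @ fs) \<and> (\<forall>e \<in> set fs. \<exists>p a. e = Do p a \<and> p \<in> S) \<and>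
    (\<forall>p \<in> S. pending (es @ fs) p = None)"
  using assms(2)
proof (induction S)
  case empty
  then show ?case
    using assms(1) by (intro exI[of _ "[]"]) auto
next
  case (insert p S)
  then obtain fs where fs: "valid (es @ fs)" "\<And>e. e \<in> set fs \<Longrightarrow> \<exists>p a. e = Do p a \<and> p \<in> S"
    "\<And>p. p \<in> S \<Longrightarrow> pending (es @ fs) p = None"
    by blast
  show ?case
  proof (cases "pending (es @ fs) p = None")
    case True
    then show ?thesis
      using fs by (intro exI[of _ fs]) blast
  next
    case False
    then obtain gs y where gs: "valid ((es @ fs) @ gs @ [Do p (Return y)])"
      "\<And>e. e \<in> set gs \<Longrightarrow> \<exists>a. e = Do p a"
      using solo_completes[OF fs(1) False] by blast
    let ?gs = "gs @ [Do p (Return y)]"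
    have who: "who e = p" if "e \<in> set ?gs" for e
      using that gs(2) by fastforce
    have "pending ((es @ fs) @ ?gs) p' = None" if "p' \<in> S" for p'
      using insert(2) that fs(3)[OF that] who
      by (subst proc_cfg_append) blast+
    moreover have "pending ((es @ fs) @ ?gs) p = None"
      using pending_snoc[of "(es @ fs) @ gs"] by simp
    ultimately show ?thesis
      using fs gs by (intro exI[of _ "fs @ ?gs"]) fastforce
  qed
qed

section \<open>What reads observe and return\<close>

lemma read_returns:
  assumes "valid (E @ [Do p (Return y)])" "pending E p = Some Read"
  shows "\<exists>v. y = Some v"
proof -
  have "v \<noteq> None \<longleftrightarrow> pend (proc (conf r t) p) = Some Read"
    if "is_run A r" "enat t < len r" "ev r t = Do p (Return v)" for r t v
    using emulation that unfolding register_emulation_def by blast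
  from this[OF assms(1), of "length E" y] show ?thesis
    using assms(2) by auto
qed

lemma read_sees_common_write:
  assumes "valid E" "pending E p = Some Read" "next_act A p (proc (cfg E) p) = Return (Some v)"
  shows "\<exists>w \<in> writes E v. \<tau> \<le> card (llabels E p w)"
proof -
  have "\<exists>w \<in> writes_of A (run_of E) v. \<tau> \<le> card (L_labels A (run_of E) p w (length E))"
    using common[unfolded common_write_def, rule_format, of "run_of E" "length E" p v] assms by simp
  then show ?thesis
    by (simp add: writes_def llabels_def)
qed

lemma llabels_invoke:
  assumes "valid (E @ [Inv p Read])"
  shows "llabels (E @ [Inv p Read]) p w = {}"
proof -
  have "ev (run_of (E @ [Inv p Read])) (length E) = Inv p Read"
    "enat (length E) < len (run_of (E @ [Inv p Read]))"
    by simp_all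
  then have "data_blocks (run_of (E @ [Inv p Read])) p (length E) = {}"
    using emulation assms unfolding register_emulation_def by blast
  then show ?thesis
    by (simp add: llabels_def L_labels_def data_blocks_def Let_def)
qed

lemma write_completes:
  assumes "valid es" "initialized es" "pending es wrt = None"
  shows "\<exists>g y. valid (es @ Inv wrt (Write u) # g) \<and> pending (es @ Inv wrt (Write u) # g) wrt = None \<and>
    (\<forall>e \<in> set g. \<exists>a. e = Do wrt a) \<and> Do wrt (Return y) \<in> set g"
proof -
  let ?es = "es @ [Inv wrt (Write u)]"
  have "es \<noteq> []"
    using assms(2) by auto
  then have v: "valid ?es"
    unfolding valid_snoc using assms by simp
  have pend: "pending ?es wrt \<noteq> None"
    by (simp only: pending_snoc) simp
  obtain fs y where fs: "valid (?es @ fs @ [Do wrt (Return y)])" "\<forall>e \<in> set fs. \<exists>a. e = Do wrt a"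
    using solo_completes[OF v pend] by blast
  have "pending ((?es @ fs) @ [Do wrt (Return y)]) wrt = None"
    by (simp only: pending_snoc) simp
  moreover have "?es @ fs @ [Do wrt (Return y)] = es @ Inv wrt (Write u) # fs @ [Do wrt (Return y)]"
    "(?es @ fs) @ [Do wrt (Return y)] = es @ Inv wrt (Write u) # fs @ [Do wrt (Return y)]"
    by simp_all
  ultimately have "valid (es @ Inv wrt (Write u) # fs @ [Do wrt (Return y)])"
    "pending (es @ Inv wrt (Write u) # fs @ [Do wrt (Return y)]) wrt = None"
    using fs(1) by metis+
  moreover have "\<forall>e \<in> set (fs @ [Do wrt (Return y)]). \<exists>a. e = Do wrt a"
    using fs(2) by simp
  moreover have "Do wrt (Return y) \<in> set (fs @ [Do wrt (Return y)])"
    by simp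
  ultimately show ?thesis
    by blast
qed

text \<open>A write invoked within \<open>es\<close> has returned there, since the writer is idle
  after \<open>es\<close>. The write of \<open>u\<close> returns after it and before the read, so
  the older write is neither concurrent with the read nor the last one before it.\<close>

lemma fresh_value:
  assumes v: "valid E" and E: "E = es @ Inv wrt (Write u) # g @ h"
    and idle: "pending es wrt = None" and ret: "Do wrt (Return z) \<in> set g"
    and i: "length es + length g < i" "E ! i = Inv p Read"
    and j: "op_returns (run_of E) i j" "E ! j = Do p (Return (Some v))"
  shows "\<exists>w \<in> writes E v. length es \<le> w"
proof -
  let ?s = "length es" and ?r = "run_of E"
  obtain n where "n < length g" "g ! n = Do wrt (Return z)"
    using ret by (auto simp: in_set_conv_nth)
  then obtain k where k: "op_returns ?r ?s k" "k < i"
    using op_returns_first[of E ?s wrt "Write u" "?s + Suc n" z] E i by (auto simp: nth_append)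
  obtain w where w: "w \<in> writes E v" "last_write_before A ?r i w \<or> concurrent ?r w i"
    using regular v i(2) j unfolding regular_def writes_def by (metis run_of_simps(3))
  have "?s \<le> w"
  proof (rule ccontr)
    assume less: "\<not> ?s \<le> w"
    then have "es ! w = Inv wrt (Write v)"
      using w(1) E by (auto simp: in_writes nth_append)
    then obtain n y where n: "w < n" "n < ?s" "es ! n = Do wrt (Return y)"
      using idle_returned[of es wrt w] idle v valid_append less unfolding E
      by (metis linorder_not_le)
    then have En: "E ! n = Do wrt (Return y)" "n < length E"
      using E by (auto simp: nth_append)
    obtain k0 where k0: "k0 \<le> n" "op_returns ?r w k0"
      using op_returns_first[of E w wrt "Write v" n y] n En w(1) by (auto simp: in_writes)
    have "?s < k"
      using k(1) by (simp add: op_returns_def)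
    from w(2) show False
    proof
      assume "concurrent ?r w i"
      then show False
        using k0 k n \<open>?s < k\<close> unfolding concurrent_def by fastforce
    next
      assume "last_write_before A ?r i w"
      moreover have "?s \<in> (\<Union>v. writes_of A ?r v)"
        using in_writes[of ?s E u] E unfolding writes_def by auto
      ultimately obtain k' where k': "op_returns ?r w k'" "k \<le> k'"
        using k unfolding last_write_before_def by blast
      \<comment> \<open>A first response to \<open>w\<close> as late as \<open>k'\<close> is
        impossible, because the writer has responded at \<open>n\<close>.\<close>
      then have "n < k'"
        using n \<open>?s < k\<close> by simp
      then show False
        using k'(1) En n(1) w(1) by (auto simp: op_returns_def in_writes)
    qed
  qed
  then show ?thesis
    using w(1) by blast
qed

text \<open>A hypothetical read by the idle reader \<open>p\<close> runs alone from \<open>E\<close>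
  and changes no block. It returns only after collecting \<open>\<tau>\<close> labels of one write,
  so these are stored at \<open>E\<close> already. That write and the recent one share their value
  but may differ.\<close>

lemma fresh_read:
  assumes v: "valid E" and E: "E = es @ Inv wrt (Write u) # g"
    and idle: "pending es wrt = None" and ret: "Do wrt (Return z) \<in> set g"
    and p: "p \<in> readers A" "pending E p = None"
  shows "\<exists>v. (\<exists>w \<in> writes E v. length es \<le> w) \<and> (\<exists>w \<in> writes E v. \<tau> \<le> card (stored E w))"
proof -
  let ?E = "E @ [Inv p Read]"
  have "initialized E" "p \<noteq> wrt"
    using ret p(1) E by (auto simp: readers_def)
  then have vE: "valid ?E"
    using v p by (auto simp: valid_snoc)
  have pE: "pending ?E p = Some Read"
    by (simp only: pending_snoc) simp
  then have "pending ?E p \<noteq> None"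
    by simp
  from solo_completes[OF vE this] obtain fs y where fs: "valid (?E @ fs @ [Do p (Return y)])"
    "\<forall>e \<in> set fs. \<exists>a. e = Do p a \<and> (\<forall>y. a \<noteq> Return y)"
    by blast
  let ?F = "?E @ fs"
  have vF: "valid (?F @ [Do p (Return y)])"
    using fs(1) by simp
  have pend: "pending ?F p = Some Read"
    using fs(2) by (intro pending_stay[OF valid_append[OF vF] pE]) auto
  obtain x where x: "y = Some x"
    using read_returns[OF vF pend] by blast
  have "next_act A p (proc (cfg ?F) p) = Return (Some x)"
    using vF x valid_snoc[of ?F "Do p (Return y)"] by auto
  then obtain w where w: "w \<in> writes ?F x" "\<tau> \<le> card (llabels ?F p w)"
    using read_sees_common_write[OF valid_append[OF vF] pend] by blast
  \<comment> \<open>Reader steps invoke no writes, so writes found after the read belong to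
    \<open>E\<close>.\<close>
  have same: "w' \<in> writes E v'" if "w' \<in> writes (E @ hs) v'" "\<And>e. e \<in> set hs \<Longrightarrow> who e \<noteq> wrt" for w' v' hs
    using that nth_mem[of "w' - length E" hs] by (fastforce simp: in_writes nth_append split: if_splits)
  have who: "who e \<noteq> wrt" if "e \<in> set fs \<or> e = Do p a \<or> e = Inv p q" for e a q
    using that fs(2) \<open>p \<noteq> wrt\<close> by auto
  \<comment> \<open>\<open>p\<close> starts with empty data, and all it meets is the storage of
    \<open>E\<close>, which reader steps leave in place.\<close>
  have "llabels (?E @ fs) p w \<subseteq> stored E w"
    using valid_append[OF vF] fs(2)
  proof (induction fs rule: rev_induct)
    case Nil
    then show ?case
      using llabels_invoke by simp
  next
    case (snoc e fs)
    have v: "valid (?E @ fs)"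
      using snoc.prems(1) valid_append[of "?E @ fs" "[e]"] by simp
    have olabels: "olabels (?E @ fs) x = olabels E x" for x
      using olabels_readers[of E "Inv p Read # fs"] v snoc.prems(2) \<open>p \<noteq> wrt\<close> by fastforce
    then have "llabels ((?E @ fs) @ [e]) p w \<subseteq> llabels (?E @ fs) p w \<union> stored E w"
      by (intro order_trans[OF llabels_snoc] Un_mono) (auto simp: stored_def olabels simp del: append_assoc)
    then show ?case
      using snoc v by auto
  qed
  then have "\<tau> \<le> card (stored E w)"
    using w(2) card_mono[OF finite_stored[OF v]] le_trans by blast
  moreover have "w \<in> writes E x"
    using same[of w "Inv p Read # fs" x] w(1) who by fastforce
  moreover have "\<exists>w' \<in> writes E x. length es \<le> w'"
  proof -
    let ?G = "?F @ [Do p (Return y)]"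
    have j: "?G ! length ?F = Do p (Return (Some x))" "?G ! length E = Inv p Read"
      using x by (auto simp: nth_append)
    have "?G ! k \<noteq> Do p (Return z)" if "length E < k" "k < length ?F" for k z
      using that bspec[OF fs(2) nth_mem, of "k - length ?E"] by (auto simp: nth_append)
    then have "op_returns (run_of ?G) (length E) (length ?F)"
      using j by (auto simp: op_returns_def)
    then obtain w' where "w' \<in> writes ?G x" "length es \<le> w'"
      using fresh_value[OF vF _ idle ret _ j(2) _ j(1), of u "Inv p Read # fs @ [Do p (Return y)]"]
      by (auto simp: E)
    then show ?thesis
      using same[of w' "Inv p Read # fs @ [Do p (Return y)]" x] who by fastforce
  qed
  ultimately show ?thesis
    by blast
qed

subsection \<open>Pinning blocks by pending readers\<close>

text \<open>In the uses below, \<open>P\<close> collects the readers suspended in the middle of a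
  read and \<open>V\<close> the values already pinned.\<close>

definition admissible where
  "admissible P V es fs \<longleftrightarrow> valid (es @ fs) \<and>
    (\<forall>e \<in> set fs. who e \<notin> P \<and> (\<forall>p v. e = Inv p (Write v) \<longrightarrow> v \<notin> V))"

text \<open>Quantifying over all admissible futures, not just the present storage, makes the
  property persist under admissible continuations.\<close>

definition frozen where
  "frozen P V es \<longleftrightarrow>
    (\<forall>v \<in> V. \<exists>w \<in> writes es v. \<forall>fs. admissible P V es fs \<longrightarrow> \<tau> - 1 \<le> card (stored (es @ fs) w))"

definition quiet where
  "quiet P es \<longleftrightarrow> valid es \<and> initialized es \<and> (\<forall>p. p \<notin> P \<longrightarrow> pending es p = None)"

text \<open>
  The invariant of the schedule against \<open>p\<close>. Its second alternative lasts once \<open>w\<close> has returned, because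
  the labels of \<open>w\<close> in the storage then only decrease.
\<close>

definition safe where
  "safe E p w \<longleftrightarrow> card (llabels E p w) \<le> 1 \<or> card (llabels E p w \<union> stored E w) \<le> \<tau> - 1"

lemma admissible_append: "admissible P V es fs \<Longrightarrow> admissible P V (es @ fs) gs \<Longrightarrow> admissible P V es (fs @ gs)"
  by (auto simp: admissible_def)

lemma admissible_mono: "admissible P' V' es fs \<Longrightarrow> P \<subseteq> P' \<Longrightarrow> V \<subseteq> V' \<Longrightarrow> admissible P V es fs"
  unfolding admissible_def by blast

lemma admissible_writes:
  assumes "admissible P V es fs" "w \<in> writes (es @ fs) v" "v \<in> V"
  shows "w < length es"
proof (rule ccontr)
  assume "\<not> w < length es"
  then have "Inv wrt (Write v) \<in> set fs"
    using assms(2) nth_mem[of "w - length es" fs] by (auto simp: in_writes nth_append)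
  then show False
    using assms(1,3) unfolding admissible_def by blast
qed

lemma frozen_admissible:
  assumes "frozen P V es" "admissible P V es fs"
  shows "frozen P V (es @ fs)"
  unfolding frozen_def
proof
  fix v
  assume "v \<in> V"
  then obtain w where w: "w \<in> writes es v" "\<And>fs. admissible P V es fs \<Longrightarrow> \<tau> - 1 \<le> card (stored (es @ fs) w)"
    using assms(1) unfolding frozen_def by blast
  have "\<tau> - 1 \<le> card (stored ((es @ fs) @ gs) w)" if "admissible P V (es @ fs) gs" for gs
    using w(2)[OF admissible_append[OF assms(2) that]] by simp
  then show "\<exists>w \<in> writes (es @ fs) v. \<forall>gs. admissible P V (es @ fs) gs \<longrightarrow> \<tau> - 1 \<le> card (stored ((es @ fs) @ gs) w)"
    using writes_append[OF w(1)] by blast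
qed

text \<open>If \<open>p\<close> gains only stored labels and the storage gains none, the union
  cannot grow, so the second alternative of \<open>safe\<close> persists.\<close>

lemma safe_antimono:
  assumes "valid E" "llabels E' p w \<subseteq> llabels E p w \<union> stored E w" "stored E' w \<subseteq> stored E w"
    "card (llabels E p w \<union> stored E w) \<le> \<tau> - 1"
  shows "safe E' p w"
proof -
  have "card (llabels E' p w \<union> stored E' w) \<le> card (llabels E p w \<union> stored E w)"
    using assms(2,3) finite_stored[OF assms(1)] llabels_bound[OF assms(1)] by (intro card_mono) auto
  then show ?thesis
    using assms(4) by (simp add: safe_def)
qed

lemma card_olabels_w: "valid E \<Longrightarrow> card (olabels E x \<inter> ({w} \<times> UNIV)) \<le> 1"
  using olabels_cases[of E x] card_mono[of "olabels E x" "olabels E x \<inter> ({w} \<times> UNIV)"] by auto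

text \<open>
  After \<open>hs\<close>, the object accessed by \<open>a\<close> still carries a label of the spoiled write \<open>w\<close>, or a label of
  a write that \<open>p\<close> has not met before.
\<close>

lemma spoil_step:
  assumes v: "valid (E @ hs @ [Do p a])" and p: "p \<noteq> wrt" and idle: "pending E wrt = None"
    and hs: "\<And>e. e \<in> set hs \<Longrightarrow> who e \<noteq> p"
    and x: "a = Get x \<or> a = Update x"
    and safe: "w' < length E \<Longrightarrow> safe E p w'"
    and w: "\<not> safe (E @ [Do p a]) p w" "w < length E" "safe E p w"
    and spoiled: "card (stored (E @ hs) w) < \<tau> - 1"
  shows "safe (E @ hs @ [Do p a]) p w'"
proof -
  let ?E = "E @ hs" and ?F = "E @ hs @ [Do p a]"
  have vE: "valid ?E"
    using v valid_append[of ?E "[Do p a]"] by simp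
  note vE0 = valid_append[OF vE]
  have llabels_E: "llabels ?E p u \<subseteq> llabels E p u" for u
    using llabels_append[OF hs] .
  have llabels_F: "llabels ?F p u \<subseteq> llabels ?E p u \<union> (olabels ?E x \<inter> ({u} \<times> UNIV))" for u
    using llabels_snoc[of ?E "Do p a" p u] x by auto
  have llabels_E0: "llabels (E @ [Do p a]) p u \<subseteq> llabels E p u \<union> (olabels E x \<inter> ({u} \<times> UNIV))" for u
    using llabels_snoc[of E "Do p a" p u] x by auto
  have stored_F: "stored ?F u = stored ?E u" for u
    using stored_readers[of ?E "[Do p a]"] v p by simp
  have stored_E: "stored ?E u \<subseteq> stored E u" if "u < length E" for u
    using stored_idle[of E "[]" hs] vE idle that by simp
  have in_stored: "olabels es x \<inter> ({u} \<times> UNIV) \<subseteq> stored es u" for es u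
    by (auto simp: stored_def)
  \<comment> \<open>\<open>p\<close> takes no step in \<open>hs\<close>, so its state and its next
    action are the same at \<open>E\<close>.\<close>
  have va: "valid (E @ [Do p a])"
  proof -
    have "enabled A (cfg ?E) (Do p a)"
      using v valid_snoc[of ?E "Do p a"] by simp
    then have "enabled A (cfg E) (Do p a)"
      using proc_cfg_append[OF hs, of hs] by simp
    moreover from this have "E \<noteq> []"
      by auto
    ultimately show ?thesis
      using vE0 by (simp add: valid_snoc)
  qed
  have stored_a: "stored (E @ [Do p a]) u = stored E u" for u
    using stored_readers[OF va] p by simp
  \<comment> \<open>The second alternative of \<open>safe\<close> would survive the step taken right
    at \<open>E\<close>, so \<open>w\<close> is safe there by the first one; the step can violate
    that only by adding a label of \<open>w\<close>.\<close>
  have small: "card (llabels E p w) \<le> 1" and label: "olabels E x \<inter> ({w} \<times> UNIV) \<noteq> {}"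
  proof -
    show c: "card (llabels E p w) \<le> 1"
      using w(1,3) safe_antimono[OF vE0, of "E @ [Do p a]" p w] llabels_E0[of w] in_stored[of E w] stored_a[of w]
      unfolding safe_def[of E] by blast
    show "olabels E x \<inter> ({w} \<times> UNIV) \<noteq> {}"
    proof
      assume "olabels E x \<inter> ({w} \<times> UNIV) = {}"
      then have "card (llabels (E @ [Do p a]) p w) \<le> card (llabels E p w)"
        using llabels_E0[of w] llabels_bound[OF vE0] by (intro card_mono) auto
      then show False
        using c w(1) by (simp add: safe_def)
    qed
  qed
  consider "w' = w" | "w' \<ge> length E" | "w' < length E" "w' \<noteq> w"
    by linarith
  then show ?thesis
  proof cases
    case 1
    \<comment> \<open>At most one label at \<open>p\<close> and at most \<open>\<tau> - 2\<close> in
      the storage satisfy the second alternative.\<close>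
    have "card (llabels ?E p w) \<le> 1"
      using small card_mono[OF _ llabels_E[of w]] llabels_bound[OF vE0] le_trans by blast
    then have "card (llabels ?E p w \<union> stored ?E w) \<le> \<tau> - 1"
      using card_Un_le[of "llabels ?E p w" "stored ?E w"] spoiled by linarith
    then show ?thesis
      unfolding 1 using llabels_F[of w] in_stored[of ?E w] stored_F[of w]
      by (intro safe_antimono[OF vE]) auto
  next
    case 2
    \<comment> \<open>\<open>p\<close> has no label of \<open>w'\<close> at \<open>E\<close>, so it
      holds at most the one met in this step.\<close>
    then have sub: "llabels ?F p w' \<subseteq> olabels ?E x \<inter> ({w'} \<times> UNIV)"
      using llabels_F[of w'] llabels_E[of w'] llabels_bound[OF vE0, of p w'] by auto
    have "finite (olabels ?E x \<inter> ({w'} \<times> UNIV))"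
      using olabels_cases[OF vE, of x] by auto
    from card_mono[OF this sub] have "card (llabels ?F p w') \<le> 1"
      using card_olabels_w[OF vE, of x w'] by linarith
    then show ?thesis
      by (simp add: safe_def)
  next
    case 3
    show ?thesis
    proof (cases "card (llabels E p w') \<le> 1")
      case True
      \<comment> \<open>The accessed object carried a label of \<open>w\<close> at \<open>E\<close>;
        after \<open>hs\<close> it has the same label or one of an operation invoked after
        \<open>E\<close>, in either case none of \<open>w'\<close>.\<close>
      have "olabels ?E x \<inter> ({w'} \<times> UNIV) = {}"
        using olabels_idle[of E "[]" hs x] vE idle label olabels_cases[OF vE0, of x] 3 by fastforce
      then have "llabels ?F p w' \<subseteq> llabels E p w'"
        using llabels_F[of w'] llabels_E[of w'] by auto
      from card_mono[OF _ this] have "card (llabels ?F p w') \<le> 1"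
        using True llabels_bound[OF vE0, of p w'] by linarith
      then show ?thesis
        by (simp add: safe_def)
    next
      case False
      then have "card (llabels E p w' \<union> stored E w') \<le> \<tau> - 1"
        using safe[OF 3(1)] by (simp add: safe_def)
      moreover have "llabels ?F p w' \<subseteq> llabels E p w' \<union> stored E w'"
        using llabels_F[of w'] llabels_E[of w'] in_stored[of ?E w'] stored_E[OF 3(1)] by blast
      ultimately show ?thesis
        using stored_F[of w'] stored_E[OF 3(1)] by (intro safe_antimono[OF vE0]) auto
    qed
  qed
qed

section \<open>Quiet extensions of runs\<close>

lemma quietD:
  assumes "quiet P es"
  shows "valid es" "initialized es" "p \<notin> P \<Longrightarrow> pending es p = None"
  using assms unfolding quiet_def by auto

lemma quiet_append:
  assumes "quiet P es" "valid (es @ fs)" "\<And>e. e \<in> set fs \<Longrightarrow> who e \<in> P"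
  shows "quiet P (es @ fs)"
proof -
  have "pending (es @ fs) p = None" if "p \<notin> P" for p
  proof -
    have "\<And>e. e \<in> set fs \<Longrightarrow> who e \<noteq> p"
      using assms(3) that by auto
    then show ?thesis
      using proc_cfg_append[of fs p es] quietD(3)[OF assms(1) that] by simp
  qed
  then show ?thesis
    using assms(2) quietD(2)[OF assms(1)] by (auto simp: quiet_def)
qed

lemma quiet_write:
  assumes "quiet P es" "wrt \<notin> P"
  shows "\<exists>g y. quiet P (es @ Inv wrt (Write u) # g) \<and> (\<forall>e \<in> set g. \<exists>a. e = Do wrt a) \<and>
    Do wrt (Return y) \<in> set g"
proof -
  obtain g y where g: "valid (es @ Inv wrt (Write u) # g)" "pending (es @ Inv wrt (Write u) # g) wrt = None"
    "\<forall>e \<in> set g. \<exists>a. e = Do wrt a" "Do wrt (Return y) \<in> set g"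
    using write_completes[OF quietD(1,2)[OF assms(1)] quietD(3)[OF assms]] by blast
  have who: "who e = wrt" if "e \<in> set (Inv wrt (Write u) # g)" for e
    using that g(3) by auto
  have "pending (es @ Inv wrt (Write u) # g) p = None" if "p \<notin> P" for p
  proof (cases "p = wrt")
    case False
    then have "proc (cfg (es @ Inv wrt (Write u) # g)) p = proc (cfg es) p"
      using who by (intro proc_cfg_append) auto
    then show ?thesis
      using quietD(3)[OF assms(1) that] by simp
  qed (use g(2) in simp)
  moreover have "initialized (es @ Inv wrt (Write u) # g)"
    using g(4) by auto
  ultimately have "quiet P (es @ Inv wrt (Write u) # g)"
    using g(1) unfolding quiet_def by blast
  then show ?thesis
    using g(3,4) by blast
qed

text \<open>Completing the operations pending outside \<open>P\<close> invokes nothing, hence stays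
  admissible, and it adds no labels of \<open>w\<close>, because the writer was idle at
  \<open>E\<close>.\<close>

lemma quiet_spoil:
  assumes E: "quiet P E" and wrt: "wrt \<notin> P" and w: "w < length E"
    and hs: "admissible P V E hs" "card (stored (E @ hs) w) < k"
  shows "\<exists>hs. admissible P V E hs \<and> quiet P (E @ hs) \<and> card (stored (E @ hs) w) < k"
proof -
  have v: "valid (E @ hs)"
    using hs(1) by (simp add: admissible_def)
  have "finite (UNIV - P)"
    by simp
  from quiesce[OF v this] obtain gs where gs: "valid ((E @ hs) @ gs)"
    "\<And>e. e \<in> set gs \<Longrightarrow> \<exists>p a. e = Do p a \<and> p \<in> UNIV - P"
    "\<And>p. p \<in> UNIV - P \<Longrightarrow> pending ((E @ hs) @ gs) p = None"
    by blast
  have "admissible P V (E @ hs) gs"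
    unfolding admissible_def using gs(1,2) by fastforce
  then have "admissible P V E (hs @ gs)"
    by (rule admissible_append[OF hs(1)])
  moreover have "quiet P (E @ hs @ gs)"
    using gs(1,3) quietD(2)[OF E] by (auto simp: quiet_def)
  moreover have "card (stored (E @ hs @ gs) w) < k"
  proof -
    have "stored (E @ hs @ gs) w \<subseteq> stored (E @ hs) w"
      using stored_idle[OF _ quietD(3)[OF E wrt] w] gs(1) by simp
    from card_mono[OF finite_stored[OF v] this] show ?thesis
      using hs(2) by simp
  qed
  ultimately show ?thesis
    by blast
qed

text \<open>If no extension pinned a further value, \<open>p\<close> could be scheduled forever:
  whenever its next step would make a write unsafe, a continuation removing blocks of that write is
  inserted first. The endless read contradicts \<open>progress\<close>.\<close>

lemma freeze_reader:
  assumes es: "quiet P es" "frozen P V es" and P: "P \<subseteq> readers A"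
    and p: "p \<in> readers A" "p \<notin> P" and u: "u \<notin> V"
  shows "\<exists>fs v. v \<notin> V \<and> quiet (insert p P) (es @ fs) \<and> frozen (insert p P) (insert v V) (es @ fs)"
proof (rule ccontr)
  assume no: "\<not> ?thesis"
  have wrt: "wrt \<notin> insert p P"
    using P p(1) by (auto simp: readers_def)
  \<comment> \<open>This complete write before the read makes \<open>fresh_value\<close> applicable:
    values of \<open>V\<close> are not written again, so the read cannot return them.\<close>
  obtain g z where g: "quiet P (es @ Inv wrt (Write u) # g)"
    "\<forall>e \<in> set g. \<exists>a. e = Do wrt a" "Do wrt (Return z) \<in> set g"
    using quiet_write[OF es(1)] wrt by blast
  define F where "F fs = Inv wrt (Write u) # g @ Inv p Read # fs" for fs
  have F: "es @ F fs = (es @ F []) @ fs" "es @ F [] = (es @ Inv wrt (Write u) # g) @ [Inv p Read]" for fs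
    by (simp_all add: F_def)
  have v0: "valid (es @ F [])"
    unfolding F(2) valid_snoc using quietD[OF g(1)] p by auto
  have pend0: "pending (es @ F []) p = Some Read"
    unfolding F(2) by (simp only: pending_snoc) simp
  \<comment> \<open>Safety is demanded only for values outside \<open>V\<close>; returning a value
    of \<open>V\<close> is excluded by regularity.\<close>
  define Q where "Q E \<longleftrightarrow> (\<exists>fs. E = es @ F fs \<and> admissible P V es (F fs) \<and> quiet (insert p P) E \<and>
    (\<forall>y. Do p (Return y) \<notin> set fs) \<and> (\<forall>v w. v \<notin> V \<longrightarrow> w \<in> writes E v \<longrightarrow> safe E p w))" for E
  show False
  proof (rule progress[of Q "es @ F []" p Read])
    have "admissible P V es (F [])"
      using v0 wrt p(2) u g(2) by (auto simp: admissible_def F_def)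
    moreover have "quiet (insert p P) (es @ F [])"
      unfolding F(2) using v0 g(1) quiet_append[of "insert p P" "es @ Inv wrt (Write u) # g" "[Inv p Read]"]
      by (auto simp: quiet_def F(2))
    moreover have "llabels (es @ F []) p w = {}" for w
      using v0 unfolding F(2) by (rule llabels_invoke)
    ultimately show "Q (es @ F [])"
      unfolding Q_def safe_def by (intro exI[of _ "[]"]) simp
  next
    show "valid E" if "Q E" for E
      using that by (auto simp: Q_def quiet_def)
    show "pending (es @ F []) p = Some Read"
      by (rule pend0)
  next
    fix E
    assume "Q E"
    then obtain fs where E: "E = es @ F fs" and ok: "admissible P V es (F fs)" and qE: "quiet (insert p P) E"
      and nr: "\<And>y. Do p (Return y) \<notin> set fs" and safe: "\<And>v w. v \<notin> V \<Longrightarrow> w \<in> writes E v \<Longrightarrow> safe E p w"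
      by (auto simp: Q_def)
    note vE = quietD(1)[OF qE]
    have pend: "pending E p = Some Read"
      using pending_stay[of "es @ F []" fs, OF _ pend0 nr] vE unfolding E F(1)[of fs] by blast
    define a where "a = next_act A p (proc (cfg E) p)"
    have "E \<noteq> []"
      by (simp add: E F_def)
    then have va: "valid (E @ [Do p a])"
      unfolding valid_snoc using vE pend by (simp add: a_def)
    have no_return: "a \<noteq> Return y" for y
    proof
      assume a: "a = Return y"
      obtain x where x: "y = Some x"
        using read_returns[of E p y] va pend a by blast
      obtain w where w: "w \<in> writes E x" "\<tau> \<le> card (llabels E p w)"
        using read_sees_common_write[OF vE pend, of x] a x a_def by metis
      \<comment> \<open>With \<open>\<tau>\<close> labels at \<open>p\<close> and
        \<open>\<tau> > 1\<close>, both alternatives of \<open>safe\<close> fail, which leaves only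
        values in \<open>V\<close>.\<close>
      have "card (llabels E p w) \<le> card (llabels E p w \<union> stored E w)"
        using llabels_bound[OF vE, of p w] finite_stored[OF vE] by (intro card_mono) auto
      then have "\<not> safe E p w"
        using w(2) tau by (auto simp: safe_def)
      then have "x \<in> V"
        using safe w(1) by blast
      let ?G = "E @ [Do p a]" and ?i = "length (es @ Inv wrt (Write u) # g)"
      have len: "length E = Suc (?i + length fs)"
        by (simp add: E F_def)
      have i: "?G ! ?i = Inv p Read"
        by (simp add: E F_def nth_append)
      have j: "?G ! length E = Do p (Return (Some x))"
        by (simp add: a x)
      have "?G ! k \<noteq> Do p (Return y)" if "?i < k" "k < length E" for k y
      proof -
        have "(xs @ fs @ ys) ! k = fs ! (k - length xs)" if "length xs \<le> k" "k < length xs + length fs"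
          for xs ys :: "('o, 'p, 'v) event list"
          using that by (auto simp: nth_append)
        from this[of "es @ F []" "[Do p a]"] have "?G ! k = fs ! (k - Suc ?i)"
          using that len unfolding E F(1)[of fs] by (simp add: F_def)
        moreover have "fs ! (k - Suc ?i) \<in> set fs"
          using that len by (intro nth_mem) linarith
        ultimately show ?thesis
          using nr[of y] by auto
      qed
      then have ret: "op_returns (run_of ?G) ?i (length E)"
        using i j len unfolding op_returns_def by auto
      have G: "?G = es @ Inv wrt (Write u) # g @ (Inv p Read # fs @ [Do p a])"
        by (simp add: E F_def)
      have "wrt \<notin> P"
        using wrt by simp
      note idle = quietD(3)[OF es(1) this]
      have "length es + length g < ?i"
        by simp
      from fresh_value[OF va G idle g(3) this i ret j]
      obtain w' where w': "w' \<in> writes ?G x" "length es \<le> w'"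
        by blast
      then have writes: "w' \<in> writes (es @ F fs) x"
        unfolding E[symmetric] by (auto simp: in_writes nth_append less_Suc_eq split: if_splits)
      then show False
        using admissible_writes[OF ok writes \<open>x \<in> V\<close>] w'(2) by simp
    qed
    then obtain x where x: "a = Get x \<or> a = Update x"
      by (cases a) auto
    have Q_step: "Q (E @ hs @ [Do p a])"
      if hs: "admissible (insert p P) V E hs" "quiet (insert p P) (E @ hs)"
        and safe: "\<And>v w. v \<notin> V \<Longrightarrow> w \<in> writes (E @ hs @ [Do p a]) v \<Longrightarrow> safe (E @ hs @ [Do p a]) p w" for hs
    proof -
      have who: "who e \<noteq> p" if "e \<in> set hs" for e
        using hs(1) that unfolding admissible_def by blast
      have "proc (cfg (E @ hs)) p = proc (cfg E) p"
        using who by (rule proc_cfg_append)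
      then have v: "valid ((E @ hs) @ [Do p a])"
        unfolding valid_snoc using quietD(1)[OF hs(2)] pend \<open>E \<noteq> []\<close> by (simp add: a_def)
      have "quiet (insert p P) ((E @ hs) @ [Do p a])"
        using v by (intro quiet_append[OF hs(2)]) auto
      moreover have "admissible P V E (hs @ [Do p a])"
        using v hs(1) p(2) unfolding admissible_def by auto
      then have "admissible P V es (F fs @ hs @ [Do p a])"
        using admissible_append[OF ok] E by simp
      then have "admissible P V es (F (fs @ hs @ [Do p a]))"
        by (simp add: F_def)
      moreover have "Do p (Return y) \<notin> set (fs @ hs @ [Do p a])" for y
        using nr no_return who by force
      moreover have "E @ hs @ [Do p a] = es @ F (fs @ hs @ [Do p a])"
        by (simp add: E F_def)
      ultimately show ?thesis
        unfolding Q_def using safe by (intro exI[of _ "fs @ hs @ [Do p a]"]) simp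
    qed
    have "\<exists>hs. Q (E @ hs @ [Do p a]) \<and> (\<forall>e \<in> set hs. who e \<noteq> p)"
    proof (cases "\<forall>v w. v \<notin> V \<longrightarrow> w \<in> writes (E @ [Do p a]) v \<longrightarrow> safe (E @ [Do p a]) p w")
      case True
      have "admissible (insert p P) V E []"
        using vE by (simp add: admissible_def)
      then show ?thesis
        using Q_step[of "[]"] True qE by (intro exI[of _ "[]"]) simp
    next
      case False
      then obtain v w where w: "v \<notin> V" "w \<in> writes (E @ [Do p a]) v" "\<not> safe (E @ [Do p a]) p w"
        by blast
      then have "w \<in> writes E v"
        by (auto simp: in_writes nth_append less_Suc_eq split: if_splits)
      \<comment> \<open>Pinning \<open>v\<close> in addition fails by assumption while the values of
        \<open>V\<close> stay pinned. The failure thus concerns \<open>v\<close>, and its write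
        \<open>w\<close> can be brought below \<open>\<tau> - 1\<close> stored labels.\<close>
      have "\<not> frozen (insert p P) (insert v V) E"
        using no w(1) qE unfolding E by blast
      moreover have "frozen P V E"
        unfolding E by (rule frozen_admissible[OF es(2) ok])
      then have "\<exists>w \<in> writes E v'. \<forall>fs. admissible (insert p P) (insert v V) E fs \<longrightarrow> \<tau> - 1 \<le> card (stored (E @ fs) w)"
        if "v' \<in> V" for v'
        using that admissible_mono[of "insert p P" "insert v V" E _ P V] unfolding frozen_def
        by (meson subset_insertI)
      ultimately obtain hs where hs: "admissible (insert p P) (insert v V) E hs" "card (stored (E @ hs) w) < \<tau> - 1"
        using \<open>w \<in> writes E v\<close> unfolding frozen_def by (metis insert_iff linorder_not_le)
      have "w < length E"
        using \<open>w \<in> writes E v\<close> by (simp add: in_writes)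
      have "admissible (insert p P) V E hs"
        using admissible_mono[OF hs(1)] by blast
      from quiet_spoil[OF qE wrt \<open>w < length E\<close> this hs(2)] obtain hs where
        hs: "admissible (insert p P) V E hs" "quiet (insert p P) (E @ hs)" "card (stored (E @ hs) w) < \<tau> - 1"
        by blast
      have who: "who e \<noteq> p" if "e \<in> set hs" for e
        using hs(1) that unfolding admissible_def by blast
      have "enabled A (cfg (E @ hs)) (Do p a)"
        using proc_cfg_append[OF who, of hs E] pend by (simp add: a_def)
      then have v: "valid (E @ hs @ [Do p a])"
        using quietD(1)[OF hs(2)] \<open>E \<noteq> []\<close> valid_snoc[of "E @ hs" "Do p a"] by simp
      have "safe (E @ hs @ [Do p a]) p w'" if "v' \<notin> V" "w' \<in> writes (E @ hs @ [Do p a]) v'" for v' w'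
      proof (rule spoil_step[OF v _ quietD(3)[OF qE wrt] who x _ w(3) \<open>w < length E\<close> _ hs(3)])
        show "p \<noteq> wrt"
          using wrt by blast
        show "safe E p w"
          using safe w(1) \<open>w \<in> writes E v\<close> by blast
        show "safe E p w'" if "w' < length E"
          using safe[OF \<open>v' \<notin> V\<close>, of w'] \<open>w' \<in> writes (E @ hs @ [Do p a]) v'\<close> that
          by (simp add: in_writes nth_append)
      qed
      then show ?thesis
        using Q_step[OF hs(1,2)] who by blast
    qed
    then obtain hs where hs: "Q (E @ hs @ [Do p a])" "\<And>e. e \<in> set hs \<Longrightarrow> who e \<noteq> p"
      by blast
    have "Do p (Return y) \<notin> set (hs @ [Do p a])" for y
      using hs(2) no_return by force
    then show "\<exists>fs. Q (E @ fs) \<and> (\<exists>a. Do p a \<in> set fs) \<and> (\<forall>y. Do p (Return y) \<notin> set fs)"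
      using hs(1) by (intro exI[of _ "hs @ [Do p a]"]) auto
  qed
qed

lemma quiet_initial: "\<exists>es. quiet {} es"
proof -
  let ?i = "Inv wrt (Write (init_val A))"
  have v: "valid ([] @ [?i])"
    unfolding valid_snoc using valid_Nil by simp
  have "pending ([] @ [?i]) wrt \<noteq> None"
    by (simp only: pending_snoc) simp
  from solo_completes[OF v this] obtain fs y where fs: "valid (([?i] @ fs) @ [Do wrt (Return y)])"
    "\<forall>e \<in> set fs. \<exists>a. e = Do wrt a \<and> (\<forall>y. a \<noteq> Return y)"
    by auto
  let ?E = "([?i] @ fs) @ [Do wrt (Return y)]"
  have "pending ?E p = None" for p
  proof (cases "p = wrt")
    case True
    then show ?thesis
      by (simp only: pending_snoc) simp
  next
    case False
    then have "proc (cfg ([] @ ?E)) p = proc (cfg []) p"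
      using fs(2) by (intro proc_cfg_append) auto
    then show ?thesis
      by simp
  qed
  then have "quiet {} ?E"
    using fs(1) unfolding quiet_def by auto
  then show ?thesis
    by blast
qed

text \<open>Nothing is pinned after the initialization; each round spends one more idle
  reader.\<close>

lemma freeze_readers:
  assumes "k \<le> card (readers A)" "k < CARD('v)"
  shows "\<exists>es P V. quiet P es \<and> frozen P V es \<and> P \<subseteq> readers A \<and> card P = k \<and> card V = k"
  using assms
proof (induction k)
  case 0
  then show ?case
    using quiet_initial by (auto simp: frozen_def)
next
  case (Suc k)
  then obtain es P V where es: "quiet P es" "frozen P V es" and P: "P \<subseteq> readers A" "card P = k" "card V = k"
    by auto
  have "P \<noteq> readers A" "V \<noteq> UNIV"
    using Suc.prems P by auto
  then obtain p u where p: "p \<in> readers A" "p \<notin> P" "u \<notin> V"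
    using P(1) by blast
  obtain fs v where "v \<notin> V" "quiet (insert p P) (es @ fs)" "frozen (insert p P) (insert v V) (es @ fs)"
    using freeze_reader[OF es P(1) p] by blast
  then show ?case
    using p P by (intro exI[of _ "es @ fs"] exI[of _ "insert p P"] exI[of _ "insert v V"]) simp
qed

subsection \<open>Counting blocks\<close>

lemma olabels_snoc_bound: "valid (E @ [e]) \<Longrightarrow> l \<in> olabels (E @ [e]) x \<Longrightarrow> fst l < length E"
  using olabels_snoc_cases[of E e x] olabels_cases[of E x] valid_append[of E "[e]"] by auto

text \<open>An event relabels at most one object, and an object has at most one label.\<close>

lemma card_stored_snoc:
  assumes "valid (E @ [e])"
  shows "card (stored (E @ [e]) w) \<le> Suc (card (stored E w))"
proof -
  have "\<exists>l. stored (E @ [e]) w \<subseteq> insert l (stored E w)"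
  proof (cases "\<exists>x. olabels (E @ [e]) x \<noteq> olabels E x")
    case True
    then obtain x where "olabels (E @ [e]) x \<noteq> olabels E x"
      by blast
    then obtain p where "e = Do p (Update x)"
      using olabels_snoc[of E e x] by (auto split: if_splits)
    then have "olabels (E @ [e]) y = olabels E y" if "y \<noteq> x" for y
      using that olabels_snoc[of E e y] by simp
    moreover obtain l where "olabels (E @ [e]) x \<subseteq> {l}"
      using olabels_cases[OF assms, of x] by auto
    ultimately have "stored (E @ [e]) w \<subseteq> insert l (stored E w)"
      unfolding stored_def by fast
    then show ?thesis
      by blast
  qed (auto simp: stored_def)
  then obtain l where l: "stored (E @ [e]) w \<subseteq> insert l (stored E w)"
    by blast
  have "finite (stored E w)"
    using finite_stored valid_append[OF assms] by blast
  then show ?thesis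
    using card_mono[OF _ l] card_insert_le_m1[of "Suc (card (stored E w))" "stored E w" l] by simp
qed

text \<open>Only the writer moves, so \<open>p\<close> stays idle and could run a whole read alone
  at any moment. By \<open>fresh_read\<close>, \<open>u1\<close> or \<open>u2\<close> then has
  \<open>\<tau>\<close> stored labels of one write throughout the write of
  \<open>u2\<close>.\<close>

lemma crossing:
  assumes es: "quiet P es" and P: "wrt \<notin> P" and p: "p \<in> readers A" "p \<notin> P"
    and u: "u1 \<notin> V" "u2 \<notin> V" "u1 \<noteq> u2"
  shows "\<exists>fs. admissible P V es fs \<and> (\<exists>w \<in> writes (es @ fs) u1. \<tau> \<le> card (stored (es @ fs) w)) \<and>
    (\<exists>w \<in> writes (es @ fs) u2. \<tau> - 1 \<le> card (stored (es @ fs) w))"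
proof -
  define has where "has v E \<longleftrightarrow> (\<exists>w \<in> writes E v. \<tau> \<le> card (stored E w))" for v E
  obtain g1 y1 where g1: "quiet P (es @ Inv wrt (Write u1) # g1)" "\<forall>e \<in> set g1. \<exists>a. e = Do wrt a"
    "Do wrt (Return y1) \<in> set g1"
    using quiet_write[OF es P] by blast
  let ?es1 = "es @ Inv wrt (Write u1) # g1"
  obtain g2 y2 where g2: "quiet P (?es1 @ Inv wrt (Write u2) # g2)" "\<forall>e \<in> set g2. \<exists>a. e = Do wrt a"
    "Do wrt (Return y2) \<in> set g2"
    using quiet_write[OF g1(1) P] by blast
  define h where "h = Inv wrt (Write u2) # g2"
  have h: "e = Inv wrt (Write u2) \<or> (\<exists>a. e = Do wrt a)" if "e \<in> set h" for e
    using that g2(2) by (auto simp: h_def)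
  \<comment> \<open>\<open>E k\<close> stops after the first \<open>k\<close> events of the second
    write, its invocation included.\<close>
  define E where "E k = ?es1 @ take k h" for k
  have vE: "valid (E k)" for k
    using quietD(1)[OF g2(1)] valid_append[of "E k" "drop k h"] by (simp add: E_def h_def)
  have idle: "pending (E k) p = None" for k
  proof -
    have "who e \<noteq> p" if "e \<in> set (take k h)" for e
      using h[OF in_set_takeD[OF that]] p(1) by (auto simp: readers_def)
    then show ?thesis
      using proc_cfg_append[of "take k h" p ?es1] quietD(3)[OF g1(1) p(2)] by (simp add: E_def)
  qed
  have late: "Inv wrt (Write v) \<in> set fs" if "w \<in> writes (xs @ fs) v" "length xs \<le> w" for w v xs fs
    using that nth_mem[of "w - length xs" fs] by (auto simp: in_writes nth_append)
  have u12: "has u1 (E k) \<or> has u2 (E k)" for k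
  proof -
    have E: "E k = es @ Inv wrt (Write u1) # g1 @ take k h"
      by (simp add: E_def)
    have "Do wrt (Return y1) \<in> set (g1 @ take k h)"
      using g1(3) by simp
    from fresh_read[OF vE E quietD(3)[OF es P] this p(1) idle]
    obtain v w where v: "has v (E k)" "w \<in> writes (E k) v" "length es \<le> w"
      unfolding has_def by blast
    from late[OF v(2)[unfolded E] v(3)] have "v = u1 \<or> v = u2"
      using g1(2) h by (auto dest: in_set_takeD)
    then show ?thesis
      using v(1) by blast
  qed
  have u1: "has u1 (E 0)"
  proof -
    have E: "E 0 = es @ Inv wrt (Write u1) # g1"
      by (simp add: E_def)
    from fresh_read[OF vE E quietD(3)[OF es P] g1(3) p(1) idle]
    obtain v w where v: "has v (E 0)" "w \<in> writes (E 0) v" "length es \<le> w"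
      unfolding has_def by blast
    from late[OF v(2)[unfolded E] v(3)] have "v = u1"
      using g1(2) by auto
    then show ?thesis
      using v(1) by blast
  qed
  have u2: "has u2 (E (length h))"
  proof -
    have E: "E (length h) = ?es1 @ Inv wrt (Write u2) # g2"
      by (simp add: E_def h_def)
    from fresh_read[OF vE E quietD(3)[OF g1(1) P] g2(3) p(1) idle]
    obtain v w where v: "has v (E (length h))" "w \<in> writes (E (length h)) v" "length ?es1 \<le> w"
      unfolding has_def by blast
    from late[OF v(2)[unfolded E] v(3)] have "v = u2"
      using g2(2) by auto
    then show ?thesis
      using v(1) by blast
  qed
  have "\<exists>k. has u1 (E k) \<and> (\<exists>w \<in> writes (E k) u2. \<tau> - 1 \<le> card (stored (E k) w))"
  proof (cases "has u1 (E (length h))")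
    case True
    then show ?thesis
      using u2 unfolding has_def by (meson diff_le_self le_trans)
  next
    case False
    \<comment> \<open>\<open>j\<close> is the moment just before \<open>u1\<close> first loses its
      \<open>\<tau>\<close> labels.\<close>
    then obtain j where j: "j < length h" "has u1 (E j)" "\<not> has u1 (E (Suc j))"
      using ex_least_nat_less[of "\<lambda>k. \<not> has u1 (E k)" "length h"] u1 by auto
    have Suc_j: "E (Suc j) = E j @ [h ! j]"
      using j(1) by (simp add: E_def take_Suc_conv_app_nth)
    obtain w where w: "w \<in> writes (E (Suc j)) u2" "\<tau> \<le> card (stored (E (Suc j)) w)"
      using u12[of "Suc j"] j(3) unfolding has_def by blast
    have v: "valid (E j @ [h ! j])"
      using vE[of "Suc j"] by (simp only: Suc_j)
    \<comment> \<open>As \<open>\<tau>\<close> is positive, some label of \<open>w\<close> is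
      stored, so \<open>w\<close> was invoked before this event and is a write of
      \<open>E j\<close>.\<close>
    have "stored (E (Suc j)) w \<noteq> {}"
      using w(2) tau by auto
    then have "w < length (E j)"
      using olabels_snoc_bound[OF v] unfolding stored_def Suc_j by fastforce
    then have "w \<in> writes (E j) u2"
      using w(1) unfolding Suc_j by (simp add: in_writes nth_append)
    moreover have "\<tau> - 1 \<le> card (stored (E j) w)"
      using card_stored_snoc[OF v, of w] w(2) unfolding Suc_j by linarith
    ultimately show ?thesis
      using j(2) by blast
  qed
  then obtain k where k: "has u1 (E k)" "\<exists>w \<in> writes (E k) u2. \<tau> - 1 \<le> card (stored (E k) w)"
    by blast
  let ?fs = "Inv wrt (Write u1) # g1 @ take k h"
  have E: "E k = es @ ?fs"
    by (simp add: E_def)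
  have "e = Inv wrt (Write u1) \<or> e = Inv wrt (Write u2) \<or> (\<exists>a. e = Do wrt a)" if "e \<in> set ?fs" for e
    using that g1(2) h[of e] in_set_takeD[of e k h] by auto
  then have "admissible P V es ?fs"
    using vE[of k] P u(1,2) unfolding admissible_def E by fastforce
  then show ?thesis
    using k unfolding E has_def by blast
qed

text \<open>Writes of distinct values have disjoint label sets, and each object contributes at most
  one label.\<close>

lemma sum_stored_le:
  assumes v: "valid E" and W: "\<And>v. v \<in> U \<Longrightarrow> W v \<in> writes E v"
  shows "(\<Sum>v\<in>U. card (stored E (W v))) \<le> CARD('o)"
proof -
  have "(\<Sum>v\<in>U. card (stored E (W v))) = card (\<Union>v\<in>U. stored E (W v))"
  proof (rule card_UN_disjoint[symmetric])
    show "\<forall>v\<in>U. \<forall>v'\<in>U. v \<noteq> v' \<longrightarrow> stored E (W v) \<inter> stored E (W v') = {}"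
    proof (intro ballI impI)
      fix v v'
      assume "v \<in> U" "v' \<in> U" "v \<noteq> v'"
      then have "W v \<noteq> W v'"
        using W[of v] W[of v'] by (auto simp: in_writes)
      then show "stored E (W v) \<inter> stored E (W v') = {}"
        by (auto simp: stored_def)
    qed
  qed (use finite_stored[OF v] in simp_all)
  also have "\<dots> \<le> card (\<Union>x. olabels E x)"
  proof (rule card_mono)
    have "finite (olabels E x)" for x
      using olabels_cases[OF v, of x] by auto
    then show "finite (\<Union>x. olabels E x)"
      by simp
  qed (auto simp: stored_def)
  also have "\<dots> \<le> (\<Sum>x\<in>UNIV. card (olabels E x))"
    by (rule card_UN_le) simp
  also have "\<dots> \<le> (\<Sum>x\<in>(UNIV :: 'o set). 1)"
  proof (rule sum_mono)
    show "card (olabels E x) \<le> 1" for x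
      using olabels_cases[OF v, of x] by auto
  qed
  finally show ?thesis
    by simp
qed

text \<open>\<open>k\<close> readers pin \<open>k\<close> values; one more reader is kept idle for
  \<open>crossing\<close>, which uses two more values. The total is
  \<open>k * (\<tau> - 1) + \<tau> + (\<tau> - 1)\<close>.\<close>

lemma objects_bound:
  assumes "k < card (readers A)" "k + 2 \<le> CARD('v)"
  shows "\<tau> + (\<tau> - 1) * (k + 1) \<le> CARD('o)"
proof -
  obtain es P V where es: "quiet P es" "frozen P V es" and P: "P \<subseteq> readers A" "card P = k" "card V = k"
    using freeze_readers[of k] assms by auto
  have "P \<noteq> readers A"
    using assms(1) P(2) by auto
  then obtain p where p: "p \<in> readers A" "p \<notin> P"
    using P(1) by blast
  have "V \<noteq> UNIV"
    using assms(2) P(3) by auto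
  then obtain u1 where u1: "u1 \<notin> V"
    by blast
  have "insert u1 V \<noteq> UNIV"
    using assms(2) P(3) card_insert_le_m1[of "k + 1" V u1] by auto
  then obtain u2 where u2: "u2 \<notin> V" "u1 \<noteq> u2"
    by blast
  have wrt: "wrt \<notin> P"
    using P(1) by (auto simp: readers_def)
  obtain fs w1 w2 where fs: "admissible P V es fs"
    and w1: "w1 \<in> writes (es @ fs) u1" "\<tau> \<le> card (stored (es @ fs) w1)"
    and w2: "w2 \<in> writes (es @ fs) u2" "\<tau> - 1 \<le> card (stored (es @ fs) w2)"
    using crossing[OF es(1) wrt p u1 u2] by blast
  let ?E = "es @ fs"
  \<comment> \<open>The crossing schedule respects \<open>P\<close> and \<open>V\<close>, so all
    pinned values keep their blocks; the empty continuation reads off the bound at this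
    moment.\<close>
  have "admissible P V ?E []"
    using fs by (simp add: admissible_def)
  then have "\<exists>w \<in> writes ?E v. \<tau> - 1 \<le> card (stored ?E w)" if "v \<in> V" for v
    using frozen_admissible[OF es(2) fs] that unfolding frozen_def by fastforce
  then obtain W0 where W0: "\<And>v. v \<in> V \<Longrightarrow> W0 v \<in> writes ?E v" "\<And>v. v \<in> V \<Longrightarrow> \<tau> - 1 \<le> card (stored ?E (W0 v))"
    by metis
  define W where "W v = (if v = u1 then w1 else if v = u2 then w2 else W0 v)" for v
  have "W v \<in> writes ?E v" if "v \<in> insert u1 (insert u2 V)" for v
    using that W0(1) w1(1) w2(1) by (auto simp: W_def)
  then have "(\<Sum>v \<in> insert u1 (insert u2 V). card (stored ?E (W v))) \<le> CARD('o)"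
    using fs by (intro sum_stored_le) (simp_all add: admissible_def)
  moreover have "(\<Sum>v \<in> insert u1 (insert u2 V). card (stored ?E (W v))) =
      card (stored ?E w1) + (card (stored ?E w2) + (\<Sum>v\<in>V. card (stored ?E (W v))))"
    using u1 u2 by (simp add: W_def)
  moreover have "(\<Sum>v\<in>V. \<tau> - 1) \<le> (\<Sum>v\<in>V. card (stored ?E (W v)))"
    using W0(2) u1 u2 by (intro sum_mono) (auto simp: W_def)
  then have "k * (\<tau> - 1) \<le> (\<Sum>v\<in>V. card (stored ?E (W v)))"
    using P(3) by simp
  ultimately have "\<tau> + ((\<tau> - 1) + k * (\<tau> - 1)) \<le> CARD('o)"
    using w1(2) w2(2) by linarith
  then show ?thesis
    by (simp add: algebra_simps)
qed

end

theorem theorem20: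
  fixes A :: "('o::finite, 'p::finite, 'v::finite, 'b, 'om, 'pm, 'l::finite) algorithm"
    and \<tau> D R :: nat
  assumes "\<tau> > 1"
    and "CARD('v) = 2 ^ D" and "(2::nat) ^ D > 1"
    and "card (readers A) = R" and "R > 1"
    and "register_emulation A"
    and "regular A"
    and "wait_free A"
    and "common_write \<tau> A"
  shows "storage_cost A \<ge> \<tau> + (\<tau> - 1) * min (2 ^ D - 1) R"
proof -
  obtain c0 where "c0 \<in> inits A"
    using assms(6) unfolding register_emulation_def by blast
  with assms interpret emulation A \<tau> c0
    by unfold_locales
  \<comment> \<open>One reader is reserved for the crossing. The minimum is at least 1, so the
    subtraction is exact, and \<open>k + 2\<close> values are available.\<close>
  define k where "k = min (2 ^ D - 1) R - 1"
  have "k < card (readers A)" "k + 2 \<le> CARD('v)" "min (2 ^ D - 1) R = k + 1"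
    unfolding k_def assms(2,4) using assms(3,5) by auto
  then show ?thesis
    using objects_bound[of k] by (simp add: storage_cost_def)
qed

end
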